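(* Assume the standing setting with (A2), (A3), (R), (A4)–(A6) and data $f\in L^2(0,T;H)$, $g\in W^{1,2}(0,T;H)\cap L^2(0,T;D(\mathcal A))$, $y_\circ\in H$. Let $K$ be the mean feedback and $\hat K$ its cubature approximation (see context), let $y_{\boldsymbol\sigma}$ and $\hat y_{\boldsymbol\sigma}$ be the corresponding closed-loop states, $u_{\boldsymbol\sigma}(t):=K(t,y_{\boldsymbol\sigma}(t))$ and $\hat u_{\boldsymbol\sigma}(t):=\hat K(t,\hat y_{\boldsymbol\sigma}(t))$. Then there are constants $C_y,C_u>0$ independent of $\boldsymbol\sigma\in\mathfrak S$ such that for all $t\in[0,T]$ $$\|y_{\boldsymbol\sigma}(t)-\hat y_{\boldsymbol\sigma}(t)\|_H\le C_y\max_{s\in[0,T]}\big(\|B^*\delta\Pi(T-s)\|_{\mathcal L(H,U)}+\|B^*\delta h(s)\|_U\big),$$ $$\|u_{\boldsymbol\sigma}(t)-\hat u_{\boldsymbol\sigma}(t)\|_U\le C_u\max_{s\in[0,T]}\big(\|B^*\delta\Pi(T-s)\|_{\mathcal L(H,U)}+\|B^*\delta h(s)\|_U\big).$$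
   Context: Standing setting: $V\subset H\subset V'$ is a Gelfand triple of separable real Hilbert spaces. $U$ is a finite-dimensional Hilbert space, $B\in\mathcal L(U,H)$, $Q,P\in\mathcal L(H)$, $T>0$. $X_T:=L^2(0,T;X)$; $W_T(V,V'):=\{w\in V_T:\dot w\in V'_T\}$. $\mathfrak S=[-1/2,1/2]^{\mathbb N}$ with the uniform product probability measure $d\boldsymbol\sigma$. For each $\boldsymbol\sigma\in\mathfrak S$, $\mathcal A_{\boldsymbol\sigma}\in\mathcal L(V,V')$ with $\langle\mathcal A_{\boldsymbol\sigma}v,w\rangle=-a(\boldsymbol\sigma;v,w)$, (A2) $a(\boldsymbol\sigma;v,v)+\rho\|v\|_H^2\ge\theta\|v\|_V^2$ for some $\rho\in\mathbb R$, $\theta>0$, (A3) $\|\mathcal A_{\boldsymbol\sigma}\|_{\mathcal L(V,V')}\le C_{\mathcal A}$. (R): $\boldsymbol\sigma\mapsto\mathcal A_{\boldsymbol\sigma}$ has all partial derivatives with $\|\partial^{\boldsymbol\nu}_{\boldsymbol\sigma}\mathcal A_{\boldsymbol\sigma}\|_{\mathcal L(V,V')}\le\tilde{\boldsymbol b}^{\boldsymbol\nu}$ for all nonzero finitely supported multi-indices $\boldsymbol\nu$, with $\tilde{\boldsymbol b}\ge0$ in $\ell^p(\mathbb N)$, $0<p\le1$. (A4) $D(\mathcal A_{\boldsymbol\sigma})=\{v\in V:\mathcal A_{\boldsymbol\sigma}v\in H\}$ is independent of $\boldsymbol\sigma$ and equals $D(\mathcal A^*_{\boldsymbol\sigma})$,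 denoted $D(\mathcal A)$; (A5) $\|\partial^{\boldsymbol\nu}_{\boldsymbol\sigma}\mathcal A_{\boldsymbol\sigma}\|_{\mathcal L(D(\mathcal A),H)}\le\tilde{\boldsymbol b}^{\boldsymbol\nu}$ for $\boldsymbol\nu\ne\mathbf0$; (A6) $\|\mathcal A_{\boldsymbol\sigma}\|_{\mathcal L(D(\mathcal A),H)}\le\widetilde C_{\mathcal A}$. $\Pi_{\boldsymbol\sigma}$ is the unique self-adjoint nonnegative solution of $\dot\Pi=\Pi\mathcal A_{\boldsymbol\sigma}+\mathcal A^*_{\boldsymbol\sigma}\Pi-\Pi BB^*\Pi+Q^*Q$, $\Pi(0)=P^*P$; with $r_{\boldsymbol\sigma}:=f+\mathcal A_{\boldsymbol\sigma}g-\dot g$, $h_{\boldsymbol\sigma}$ solves $-\dot h_{\boldsymbol\sigma}=(\mathcal A^*_{\boldsymbol\sigma}-\Pi_{\boldsymbol\sigma}(T-t)BB^* )h_{\boldsymbol\sigma}+\Pi_{\boldsymbol\sigma}(T-t)r_{\boldsymbol\sigma}$, $h_{\boldsymbol\sigma}(T)=0$. For $s\in\mathbb N$, $\Pi_{\boldsymbol\sigma,s}:=\Pi_{(\sigma_1,\dots,\sigma_s,0,0,\dots)}$ and $h_{\boldsymbol\sigma,s}$ likewise. Mean feedback: $K(t,x):=-B^*\Pi(T-t)x-B^*h(t)$ with $B^*\Pi:=\int_{\mathfrak S}B^*\Pi_{\boldsymbol\sigma}\,d\boldsymbol\sigma$, $B^*h:=\int_{\mathfrak S}B^*h_{\boldsymbol\sigma}\,d\boldsymbol\sigma$.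 Cubature approximation with weights $\alpha_k\in\mathbb R$ and nodes $\boldsymbol\sigma_1,\dots,\boldsymbol\sigma_N\in[-1/2,1/2]^s$: $\hat K(t,x):=-B^*\hat\Pi(T-t)x-B^*\hat h(t)$ with $B^*\hat\Pi:=\sum_k\alpha_kB^*\Pi_{\boldsymbol\sigma_k,s}$, $B^*\hat h:=\sum_k\alpha_kB^*h_{\boldsymbol\sigma_k,s}$; $B^*\delta\Pi:=B^*\Pi-B^*\hat\Pi$, $B^*\delta h:=B^*h-B^*\hat h$. Closed-loop states: $\dot y_{\boldsymbol\sigma}=\mathcal A_{\boldsymbol\sigma}y_{\boldsymbol\sigma}+BK(t,y_{\boldsymbol\sigma})+f$ and $\dot{\hat y}_{\boldsymbol\sigma}=\mathcal A_{\boldsymbol\sigma}\hat y_{\boldsymbol\sigma}+B\hat K(t,\hat y_{\boldsymbol\sigma})+f$, both with initial value $y_\circ$. *)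

theory Defs
  imports "HOL-Probability.Probability"
begin

text \<open>The parameter cube [-1/2,1/2]^N (coordinates indexed from 0 instead of 1)
  and the uniform product probability measure on it.\<close>

definition Sfrak :: "(nat \<Rightarrow> real) set" where
  "Sfrak = {\<sigma>. \<forall>i. \<sigma> i \<in> {-1/2..1/2}}"

definition Smeas :: "(nat \<Rightarrow> real) measure" where
  "Smeas = PiM UNIV (\<lambda>_. restrict_space lborel {-1/2..1/2::real})"

definition trunc :: "nat \<Rightarrow> (nat \<Rightarrow> real) \<Rightarrow> (nat \<Rightarrow> real)" where
  "trunc s \<sigma> = (\<lambda>i. if i < s then \<sigma> i else 0)"

definition fin_supp :: "(nat \<Rightarrow> nat) \<Rightarrow> bool" where
  "fin_supp \<nu> \<longleftrightarrow> finite {j. \<nu> j \<noteq> 0}"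

definition bpow :: "(nat \<Rightarrow> real) \<Rightarrow> (nat \<Rightarrow> nat) \<Rightarrow> real" where
  "bpow b \<nu> = (\<Prod>j\<in>{j. \<nu> j \<noteq> 0}. b j ^ \<nu> j)"

definition incr :: "(nat \<Rightarrow> nat) \<Rightarrow> nat \<Rightarrow> (nat \<Rightarrow> nat)" where
  "incr \<nu> j = \<nu>(j := Suc (\<nu> j))"

definition has_partials ::
  "((nat \<Rightarrow> real) \<Rightarrow> 'b::real_normed_vector) \<Rightarrow> ((nat \<Rightarrow> nat) \<Rightarrow> (nat \<Rightarrow> real) \<Rightarrow> 'b) \<Rightarrow> bool" where
  "has_partials F D \<longleftrightarrow>
     (\<forall>\<sigma>\<in>Sfrak. D (\<lambda>_. 0) \<sigma> = F \<sigma>) \<and>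
     (\<forall>\<nu> j \<sigma>. fin_supp \<nu> \<longrightarrow> \<sigma> \<in> Sfrak \<longrightarrow>
        ((\<lambda>t. D \<nu> (\<sigma>(j := t))) has_vector_derivative D (incr \<nu> j) \<sigma>)
          (at (\<sigma> j) within {-1/2..1/2}))"

text \<open>V is a Hilbert space embedded by iota into H (continuous, injective, dense range);
  an element phi of V' is a bounded functional on V; h in H acts as w \<mapsto> <h, iota w>.\<close>
definition gelfand :: "('v::real_inner \<Rightarrow>\<^sub>L 'h::real_inner) \<Rightarrow> bool" where
  "gelfand \<iota> \<longleftrightarrow> inj (blinfun_apply \<iota>) \<and> closure (range (blinfun_apply \<iota>)) = UNIV"

definition Hrep :: "('v::real_inner \<Rightarrow>\<^sub>L 'h::real_inner) \<Rightarrow> ('v \<Rightarrow>\<^sub>L real) \<Rightarrow> 'h \<Rightarrow> bool" where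
  "Hrep \<iota> \<phi> h \<longleftrightarrow> (\<forall>w. blinfun_apply \<phi> w = inner h (blinfun_apply \<iota> w))"

text \<open>Op v w = <Op v, w>_{V',V}; D(Op) = {v. Op v \<in> H}, D(Op^*) = {v. Op^* v \<in> H}.\<close>
definition Dom :: "('v::real_inner \<Rightarrow>\<^sub>L 'h::real_inner) \<Rightarrow> ('v \<Rightarrow>\<^sub>L 'v \<Rightarrow>\<^sub>L real) \<Rightarrow> 'v set" where
  "Dom \<iota> Op = {v. \<exists>h. Hrep \<iota> (blinfun_apply Op v) h}"

definition DomAdj :: "('v::real_inner \<Rightarrow>\<^sub>L 'h::real_inner) \<Rightarrow> ('v \<Rightarrow>\<^sub>L 'v \<Rightarrow>\<^sub>L real) \<Rightarrow> 'v set" where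
  "DomAdj \<iota> Op = {v. \<exists>h. \<forall>w. blinfun_apply (blinfun_apply Op w) v = inner h (blinfun_apply \<iota> w)}"

definition Arep :: "('v::real_inner \<Rightarrow>\<^sub>L 'h::real_inner) \<Rightarrow> ('v \<Rightarrow>\<^sub>L 'v \<Rightarrow>\<^sub>L real) \<Rightarrow> 'v \<Rightarrow> 'h" where
  "Arep \<iota> Op v = (THE h. Hrep \<iota> (blinfun_apply Op v) h)"

definition normDA ::
  "('v::real_inner \<Rightarrow>\<^sub>L 'h::real_inner) \<Rightarrow> ((nat \<Rightarrow> real) \<Rightarrow> ('v \<Rightarrow>\<^sub>L 'v \<Rightarrow>\<^sub>L real)) \<Rightarrow> 'v \<Rightarrow> real" where
  "normDA \<iota> A v = norm v + norm (Arep \<iota> (A (\<lambda>_. 0)) v)"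

text \<open>E is the family of partial derivatives of sigma \<mapsto> A_sigma in L(D(A),H) (operator norm
  of L(D(A),H), D(A) with the graph norm).\<close>
definition has_partials_DA ::
  "('v::real_inner \<Rightarrow>\<^sub>L 'h::real_inner) \<Rightarrow> ((nat \<Rightarrow> real) \<Rightarrow> ('v \<Rightarrow>\<^sub>L 'v \<Rightarrow>\<^sub>L real))
    \<Rightarrow> ((nat \<Rightarrow> nat) \<Rightarrow> (nat \<Rightarrow> real) \<Rightarrow> 'v \<Rightarrow> 'h) \<Rightarrow> bool" where
  "has_partials_DA \<iota> A E \<longleftrightarrow>
     (\<forall>\<sigma>\<in>Sfrak. \<forall>v\<in>Dom \<iota> (A (\<lambda>_. 0)). E (\<lambda>_. 0) \<sigma> v = Arep \<iota> (A \<sigma>) v) \<and>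
     (\<forall>\<nu> j \<sigma>. fin_supp \<nu> \<longrightarrow> \<sigma> \<in> Sfrak \<longrightarrow>
        (\<forall>\<epsilon>>0. \<exists>\<delta>>0. \<forall>t\<in>{-1/2..1/2}. 0 < \<bar>t - \<sigma> j\<bar> \<and> \<bar>t - \<sigma> j\<bar> < \<delta> \<longrightarrow>
           (\<forall>v\<in>Dom \<iota> (A (\<lambda>_. 0)).
              norm (E \<nu> (\<sigma>(j := t)) v - E \<nu> \<sigma> v - (t - \<sigma> j) *\<^sub>R E (incr \<nu> j) \<sigma> v)
                \<le> \<epsilon> * \<bar>t - \<sigma> j\<bar> * normDA \<iota> A v)))"

definition adjB :: "('u::euclidean_space \<Rightarrow>\<^sub>L 'h::real_inner) \<Rightarrow> 'h \<Rightarrow> 'u" where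
  "adjB B x = (\<Sum>i\<in>Basis. inner (blinfun_apply B i) x *\<^sub>R i)"

definition L2 :: "real \<Rightarrow> (real \<Rightarrow> 'a::real_normed_vector) \<Rightarrow> bool" where
  "L2 T f \<longleftrightarrow> set_borel_measurable lborel {0..T} f \<and> set_integrable lborel {0..T} (\<lambda>t. (norm (f t))\<^sup>2)"

text \<open>Closed-loop state y in W_T(V,V') (H-continuous version yH, V-valued L2 version yV):
  d/dt y = Op y + B F(t,y) + f, y(0) = y0, in weak (integrated) form tested with all w in V.\<close>
definition closed_loop_sol ::
  "real \<Rightarrow> ('v::real_inner \<Rightarrow>\<^sub>L 'h::real_inner) \<Rightarrow> ('v \<Rightarrow>\<^sub>L 'v \<Rightarrow>\<^sub>L real) \<Rightarrow> ('u::euclidean_space \<Rightarrow>\<^sub>L 'h)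
    \<Rightarrow> (real \<Rightarrow> 'h \<Rightarrow> 'u) \<Rightarrow> (real \<Rightarrow> 'h) \<Rightarrow> 'h \<Rightarrow> (real \<Rightarrow> 'h) \<Rightarrow> (real \<Rightarrow> 'v) \<Rightarrow> bool" where
  "closed_loop_sol T \<iota> Op B F f y0 yH yV \<longleftrightarrow>
     continuous_on {0..T} yH \<and> L2 T yV \<and>
     (AE t in lborel. t \<in> {0..T} \<longrightarrow> blinfun_apply \<iota> (yV t) = yH t) \<and> yH 0 = y0 \<and>
     (\<forall>w. \<forall>t\<in>{0..T}.
        set_integrable lborel {0..t}
          (\<lambda>s. blinfun_apply (blinfun_apply Op (yV s)) w
               + inner (blinfun_apply B (F s (yH s)) + f s) (blinfun_apply \<iota> w)) \<and>
        inner (yH t) (blinfun_apply \<iota> w) = inner y0 (blinfun_apply \<iota> w) +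
          set_lebesgue_integral lborel {0..t}
          (\<lambda>s. blinfun_apply (blinfun_apply Op (yV s)) w
               + inner (blinfun_apply B (F s (yH s)) + f s) (blinfun_apply \<iota> w)))"

text \<open>Self-adjoint nonnegative (weak) solution of the Riccati equation
  d/dt Pm = Pm Op + Op^* Pm - Pm B B^* Pm + Q^* Q, Pm(0) = P^* P, on [0,T],
  tested with x, z in D(Op); Pm strongly continuous.\<close>
definition riccati_sol ::
  "real \<Rightarrow> ('v::real_inner \<Rightarrow>\<^sub>L 'h::real_inner) \<Rightarrow> ('v \<Rightarrow>\<^sub>L 'v \<Rightarrow>\<^sub>L real) \<Rightarrow> ('u::euclidean_space \<Rightarrow>\<^sub>L 'h)
    \<Rightarrow> ('h \<Rightarrow>\<^sub>L 'h) \<Rightarrow> ('h \<Rightarrow>\<^sub>L 'h) \<Rightarrow> (real \<Rightarrow> ('h \<Rightarrow>\<^sub>L 'h)) \<Rightarrow> bool" where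
  "riccati_sol T \<iota> Op B Q P Pm \<longleftrightarrow>
     (\<forall>t\<in>{0..T}. \<forall>x z. inner (blinfun_apply (Pm t) x) z = inner x (blinfun_apply (Pm t) z)
                      \<and> inner (blinfun_apply (Pm t) x) x \<ge> 0) \<and>
     (\<forall>x. continuous_on {0..T} (\<lambda>t. blinfun_apply (Pm t) x)) \<and>
     (\<forall>x z. inner (blinfun_apply (Pm 0) x) z = inner (blinfun_apply P x) (blinfun_apply P z)) \<and>
     (\<forall>x\<in>Dom \<iota> Op. \<forall>z\<in>Dom \<iota> Op. \<forall>t\<in>{0..T}.
        let G = (\<lambda>s. inner (blinfun_apply (Pm s) (blinfun_apply \<iota> x)) (Arep \<iota> Op z)
                   + inner (Arep \<iota> Op x) (blinfun_apply (Pm s) (blinfun_apply \<iota> z))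
                   - inner (adjB B (blinfun_apply (Pm s) (blinfun_apply \<iota> x)))
                           (adjB B (blinfun_apply (Pm s) (blinfun_apply \<iota> z)))
                   + inner (blinfun_apply Q (blinfun_apply \<iota> x)) (blinfun_apply Q (blinfun_apply \<iota> z)))
        in set_integrable lborel {0..t} G \<and>
           inner (blinfun_apply (Pm t) (blinfun_apply \<iota> x)) (blinfun_apply \<iota> z)
             = inner (blinfun_apply P (blinfun_apply \<iota> x)) (blinfun_apply P (blinfun_apply \<iota> z))
               + set_lebesgue_integral lborel {0..t} G)"

text \<open>Weak solution (in W_T(V,V')) of the backward equation
  -d/dt h = (Op^* - Pm(T-t) B B^*) h + Pm(T-t) r, h(T) = 0.\<close>
definition adj_sol ::
  "real \<Rightarrow> ('v::real_inner \<Rightarrow>\<^sub>L 'h::real_inner) \<Rightarrow> ('v \<Rightarrow>\<^sub>L 'v \<Rightarrow>\<^sub>L real) \<Rightarrow> ('u::euclidean_space \<Rightarrow>\<^sub>L 'h)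
    \<Rightarrow> (real \<Rightarrow> ('h \<Rightarrow>\<^sub>L 'h)) \<Rightarrow> (real \<Rightarrow> 'h) \<Rightarrow> (real \<Rightarrow> 'h) \<Rightarrow> (real \<Rightarrow> 'v) \<Rightarrow> bool" where
  "adj_sol T \<iota> Op B Pm r hH hV \<longleftrightarrow>
     continuous_on {0..T} hH \<and> L2 T hV \<and>
     (AE t in lborel. t \<in> {0..T} \<longrightarrow> blinfun_apply \<iota> (hV t) = hH t) \<and> hH T = 0 \<and>
     (\<forall>w. \<forall>t\<in>{0..T}.
        let G = (\<lambda>s. blinfun_apply (blinfun_apply Op w) (hV s)
                   - inner (blinfun_apply (Pm (T - s)) (blinfun_apply B (adjB B (hH s)))) (blinfun_apply \<iota> w)
                   + inner (blinfun_apply (Pm (T - s)) (r s)) (blinfun_apply \<iota> w))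
        in set_integrable lborel {t..T} G \<and>
           inner (hH t) (blinfun_apply \<iota> w) = set_lebesgue_integral lborel {t..T} G)"

definition meanBPi :: "(('h::real_inner) \<Rightarrow> 'u::euclidean_space) \<Rightarrow> ((nat \<Rightarrow> real) \<Rightarrow> real \<Rightarrow> ('h \<Rightarrow>\<^sub>L 'h))
    \<Rightarrow> real \<Rightarrow> 'h \<Rightarrow> 'u" where
  "meanBPi Bs Pm \<tau> x = lebesgue_integral Smeas (\<lambda>\<sigma>. Bs (blinfun_apply (Pm \<sigma> \<tau>) x))"

definition meanBh :: "(('h::real_inner) \<Rightarrow> 'u::euclidean_space) \<Rightarrow> ((nat \<Rightarrow> real) \<Rightarrow> real \<Rightarrow> 'h) \<Rightarrow> real \<Rightarrow> 'u" where
  "meanBh Bs h t = lebesgue_integral Smeas (\<lambda>\<sigma>. Bs (h \<sigma> t))"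

definition cubBPi :: "(('h::real_inner) \<Rightarrow> 'u::euclidean_space) \<Rightarrow> ((nat \<Rightarrow> real) \<Rightarrow> real \<Rightarrow> ('h \<Rightarrow>\<^sub>L 'h))
    \<Rightarrow> nat \<Rightarrow> nat \<Rightarrow> (nat \<Rightarrow> real) \<Rightarrow> (nat \<Rightarrow> nat \<Rightarrow> real) \<Rightarrow> real \<Rightarrow> 'h \<Rightarrow> 'u" where
  "cubBPi Bs Pm s N \<alpha> nd \<tau> x = (\<Sum>k<N. \<alpha> k *\<^sub>R Bs (blinfun_apply (Pm (trunc s (nd k)) \<tau>) x))"

definition cubBh :: "(('h::real_inner) \<Rightarrow> 'u::euclidean_space) \<Rightarrow> ((nat \<Rightarrow> real) \<Rightarrow> real \<Rightarrow> 'h)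
    \<Rightarrow> nat \<Rightarrow> nat \<Rightarrow> (nat \<Rightarrow> real) \<Rightarrow> (nat \<Rightarrow> nat \<Rightarrow> real) \<Rightarrow> real \<Rightarrow> 'u" where
  "cubBh Bs h s N \<alpha> nd t = (\<Sum>k<N. \<alpha> k *\<^sub>R Bs (h (trunc s (nd k)) t))"

end

theory Submission
  imports Defs
begin

text \<open>The difference e of the two closed-loop states solves e' = A e + B (K(y) - Khat(yhat)), and
  K(y) - Khat(yhat) is minus the sum of (B*dPi) y, (B*Pihat) e and B*dh; since |y| is at most |e| + |yhat|,
  Gronwall's inequality gives the claim once B*Pi_sigma and yhat are bounded uniformly in sigma.
  Both bounds, and the estimate of e, come from one device that needs neither a semigroup nor an energy
  identity: the weak equation is tested along the implicit Euler iterates x_j = (I - eps A)^(-j) x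
  (with the adjoint of A for the evolution equations). These satisfy eps A x_j = x_j - x_(j-1),
  so the unbounded terms telescope, up to an error that vanishes as eps tends to 0 when x lies in D(A^2).
  Any admissible M bounds the operator norms of B*dPi uniformly in time, so no regularity of
  sigma \<mapsto> Pi_sigma is used; in particular the mean feedback, whose integral could be the junk
  value 0, is never treated as linear.\<close>

section \<open>Functional-analytic preliminaries\<close>

text \<open>The weak equations admit only fixed test vectors, while a bound at time t calls for test
  vectors that follow the flow of A or of its adjoint backward in time. The iterates replace that
  flow: x_j is used at time t - j eps, and summing the increments is a discrete Duhamel formula.
  Freezing the unbounded term within a step costs differently in the two cases. A state is norm
  continuous, hence uniformly so on [0,T], and bounded A x_j suffice. A Riccati solution is only
  strongly continuous, with a modulus that depends on the vector; on pairs from D(A), however, its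
  equation makes it Lipschitz in time, and as one of the vectors is A x_j, x must lie in D(A^2). The
  Lipschitz constant and the operator norm bound of the solution may depend on sigma, but they
  multiply only the vanishing error. What survives depends on rho, T, P and Q, because the quadratic
  Riccati term has a favourable sign. Of the two states only yhat is bounded a priori: its feedback
  involves finitely many h_sigma, whereas no bound of h_sigma uniform in sigma is
  established.\<close>

lemma riesz_representation:
  fixes \<phi> :: "'a::{real_inner,complete_space} \<Rightarrow> real"
  assumes "bounded_linear \<phi>"
  obtains v where "\<And>w. \<phi> w = v \<bullet> w"
proof -
  interpret bounded_linear \<phi> by fact
  obtain K where K: "\<And>x. norm (\<phi> x) \<le> norm x * K" using pos_bounded by blast
  \<comment> \<open>The representer is the minimizer of \<open>F\<close>. In
    \<open>F v + F w - 2 * F ((1/2) *\<^sub>R (v + w))\<close> the linear parts cancel, which leaves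
    the parallelogram law and makes a minimizing sequence Cauchy.\<close>
  define F where "F v = v \<bullet> v - 2 * \<phi> v" for v
  have F_ge: "F v \<ge> - K\<^sup>2" for v
  proof -
    have "\<phi> v \<le> norm v * K" using K[of v] by simp
    moreover have "0 \<le> (norm v - K)\<^sup>2" by simp
    ultimately show ?thesis
      unfolding F_def by (simp add: power2_norm_eq_inner[symmetric] power2_diff)
  qed
  have bdd: "bdd_below (range F)" using F_ge by (intro bdd_belowI[of _ "- K\<^sup>2"]) auto
  define I where "I = Inf (range F)"
  have I_le: "I \<le> F v" for v unfolding I_def using bdd by (intro cInf_lower) auto
  have "\<exists>v. F v < I + 1 / Suc n" for n
    using cInf_lessD[of "range F" "I + 1 / Suc n"] unfolding I_def by auto
  then obtain u where u: "F (u n) < I + 1 / Suc n" for n by metis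
  have parallelogram: "(norm (v - w))\<^sup>2 \<le> 2 * (F v - I) + 2 * (F w - I)" for v w
  proof -
    have "(norm (v - w))\<^sup>2 = 2 * F v + 2 * F w - 4 * F ((1/2) *\<^sub>R (v + w))"
      unfolding F_def power2_norm_eq_inner
      by (simp add: inner_simps scaleR add inner_commute algebra_simps)
    then show ?thesis using I_le[of "(1/2) *\<^sub>R (v + w)"] by argo
  qed
  have "Cauchy u"
  proof (rule metric_CauchyI)
    fix e :: real assume e: "e > 0"
    then obtain N where N: "1 / Suc N < e\<^sup>2 / 4"
      using nat_approx_posE[of "e\<^sup>2 / 4"] by auto
    show "\<exists>M. \<forall>m\<ge>M. \<forall>n\<ge>M. dist (u m) (u n) < e"
    proof (intro exI allI impI)
      fix m n assume mn: "m \<ge> N" "n \<ge> N"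
      have "1 / real (Suc m) \<le> 1 / Suc N" "1 / real (Suc n) \<le> 1 / Suc N"
        using mn by (auto simp: frac_le)
      then have "(norm (u m - u n))\<^sup>2 < e\<^sup>2"
        using parallelogram[of "u m" "u n"] u[of m] u[of n] N by argo
      then show "dist (u m) (u n) < e"
        using e by (simp add: dist_norm power_less_imp_less_base)
    qed
  qed
  then obtain v where v: "u \<longlonglongrightarrow> v" using Cauchy_convergent_iff convergent_def by blast
  have "(\<lambda>n. F (u n)) \<longlonglongrightarrow> F v"
    unfolding F_def by (intro tendsto_intros v tendsto)
  moreover have "(\<lambda>n. I + 1 / Suc n) \<longlonglongrightarrow> I + 0"
    by (intro tendsto_intros LIMSEQ_Suc[OF lim_1_over_n])
  ultimately have Fv: "F v \<le> I"
    using LIMSEQ_le[of "\<lambda>n. F (u n)" "F v" "\<lambda>n. I + 1 / Suc n" I] u by (auto simp: less_imp_le)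
  have "\<phi> w = v \<bullet> w" for w
  proof (cases "w = 0")
    case False
    define d where "d = v \<bullet> w - \<phi> w"
    \<comment> \<open>The minimizer of \<open>F\<close> along the line through \<open>v\<close> in
      direction \<open>w\<close>: a nonzero \<open>d\<close> would lower \<open>F v\<close> by
      \<open>d\<^sup>2 / (w \<bullet> w)\<close>, below the infimum.\<close>
    define t where "t = - d / (w \<bullet> w)"
    have ww: "w \<bullet> w > 0" using False by simp
    have "F (v + t *\<^sub>R w) = F v + t * (t * (w \<bullet> w)) + 2 * t * d"
      unfolding F_def d_def by (simp add: inner_simps scaleR add inner_commute algebra_simps)
    also have "\<dots> = F v - d\<^sup>2 / (w \<bullet> w)"
      using ww unfolding t_def by (simp add: field_simps power2_eq_square)
    finally have "d\<^sup>2 / (w \<bullet> w) \<le> 0" using Fv I_le[of "v + t *\<^sub>R w"] by linarith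
    then have "d = 0" using ww by (simp add: divide_le_0_iff)
    then show ?thesis by (simp add: d_def)
  qed (simp add: zero)
  then show ?thesis using that by blast
qed

text \<open>Without symmetry of the form a solution is no longer a minimizer. The equation is read
  as the fixed point problem \<open>v - \<kappa> *\<^sub>R (S v - f) = v\<close>, with
  \<open>S\<close> the Riesz operator of \<open>a\<close>; coercivity makes this map a
  contraction.\<close>

lemma lax_milgram:
  fixes a :: "'a::{real_inner,complete_space} \<Rightarrow> 'a \<Rightarrow> real"
  assumes a: "bounded_bilinear a" and \<phi>: "bounded_linear \<phi>"
    and \<alpha>: "\<alpha> > 0" and coercive: "\<And>v. \<alpha> * (norm v)\<^sup>2 \<le> a v v"
  obtains v where "\<And>w. a v w = \<phi> w"
proof -
  interpret a: bounded_bilinear a by fact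
  obtain K0 where K0: "\<And>v w. norm (a v w) \<le> norm v * norm w * K0"
    using a.pos_bounded by blast
  \<comment> \<open>\<open>\<alpha> \<le> K\<close> keeps the squared contraction factor
    \<open>1 - \<alpha>\<^sup>2 / K\<^sup>2\<close> nonnegative. That factor is the minimum of
    \<open>1 - 2 * \<kappa> * \<alpha> + \<kappa>\<^sup>2 * K\<^sup>2\<close>, attained at
    \<open>\<kappa> = \<alpha> / K\<^sup>2\<close>.\<close>
  define K where "K = max K0 \<alpha>"
  have K: "K > 0" "\<alpha> \<le> K" using \<alpha> by (auto simp: K_def)
  have aK: "a v w \<le> norm v * norm w * K" for v w
  proof -
    have "norm v * norm w * K0 \<le> norm v * norm w * K"
      by (intro mult_left_mono) (auto simp: K_def)
    then show ?thesis using K0[of v w] by simp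
  qed
  have "\<exists>z. \<forall>w. a v w = z \<bullet> w" for v
    using riesz_representation[OF a.bounded_linear_right[of v]] by metis
  then obtain S where S: "a v w = S v \<bullet> w" for v w by metis
  obtain f where f: "\<phi> w = f \<bullet> w" for w using riesz_representation[OF \<phi>] by metis
  define \<kappa> where "\<kappa> = \<alpha> / K\<^sup>2"
  have \<kappa>: "\<kappa> > 0" using \<alpha> K by (simp add: \<kappa>_def)
  define g where "g v = v - \<kappa> *\<^sub>R (S v - f)" for v
  define c where "c = sqrt (1 - \<alpha>\<^sup>2 / K\<^sup>2)"
  have \<alpha>K: "\<alpha>\<^sup>2 / K\<^sup>2 \<le> 1" "\<alpha>\<^sup>2 / K\<^sup>2 > 0"
    using K \<alpha> by (auto simp: divide_le_eq power_mono)
  then have c: "0 \<le> c" "c < 1" by (auto simp: c_def)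
  have "dist (g v) (g u) \<le> c * dist v u" for v u
  proof -
    define d where "d = v - u"
    define q where "q = S v - S u"
    have q: "q \<bullet> w = a d w" for w
      by (simp add: q_def d_def inner_diff_left S[symmetric] a.diff_left)
    have "norm q \<le> K * norm d"
    proof (cases "q = 0")
      case False
      have "norm q * norm q \<le> norm q * (K * norm d)"
        using aK[of d q] q[of q] by (simp add: dot_square_norm power2_eq_square mult_ac)
      then show ?thesis using False by simp
    qed (use K in auto)
    then have "(norm q)\<^sup>2 \<le> K\<^sup>2 * (norm d)\<^sup>2"
      by (metis norm_ge_zero power_mono power_mult_distrib)
    then have q2: "\<kappa>\<^sup>2 * (norm q)\<^sup>2 \<le> \<kappa>\<^sup>2 * (K\<^sup>2 * (norm d)\<^sup>2)"
      by (intro mult_left_mono) auto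
    have "(norm (d - \<kappa> *\<^sub>R q))\<^sup>2 = (norm d)\<^sup>2 - 2 * \<kappa> * (q \<bullet> d) + \<kappa>\<^sup>2 * (norm q)\<^sup>2"
      unfolding power2_norm_eq_inner
      by (simp add: inner_simps inner_commute power2_eq_square algebra_simps)
    also have "\<dots> \<le> (norm d)\<^sup>2 - 2 * \<kappa> * (\<alpha> * (norm d)\<^sup>2) + \<kappa>\<^sup>2 * (K\<^sup>2 * (norm d)\<^sup>2)"
    proof -
      have "2 * \<kappa> * (\<alpha> * (norm d)\<^sup>2) \<le> 2 * \<kappa> * (q \<bullet> d)"
        using coercive[of d] \<kappa> by (intro mult_left_mono) (auto simp: q)
      then show ?thesis using q2 by linarith
    qed
    also have "\<dots> = (1 - \<alpha>\<^sup>2 / K\<^sup>2) * (norm d)\<^sup>2"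
    proof -
      have *: "\<kappa> * \<alpha> = \<alpha>\<^sup>2 / K\<^sup>2" "\<kappa>\<^sup>2 * K\<^sup>2 = \<alpha>\<^sup>2 / K\<^sup>2"
        using K by (auto simp: \<kappa>_def power2_eq_square)
      have "\<kappa> * (\<alpha> * (norm d)\<^sup>2) = \<alpha>\<^sup>2 / K\<^sup>2 * (norm d)\<^sup>2"
        unfolding *(1)[symmetric] by (rule mult.assoc[symmetric])
      moreover have "\<kappa>\<^sup>2 * (K\<^sup>2 * (norm d)\<^sup>2) = \<alpha>\<^sup>2 / K\<^sup>2 * (norm d)\<^sup>2"
        unfolding *(2)[symmetric] by (rule mult.assoc[symmetric])
      ultimately show ?thesis by (simp add: left_diff_distrib)
    qed
    also have "\<dots> = (c * norm d)\<^sup>2"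
      using \<alpha>K by (simp add: c_def power_mult_distrib)
    finally have "norm (d - \<kappa> *\<^sub>R q) \<le> c * norm d"
      by (rule power2_le_imp_le) (use c in simp)
    moreover have "g v - g u = d - \<kappa> *\<^sub>R q"
      by (simp add: g_def d_def q_def algebra_simps)
    ultimately show ?thesis by (simp add: dist_norm d_def)
  qed
  then have "\<exists>!v. g v = v"
    using banach_fix_type[of c g] c by simp
  then obtain v where "g v = v" by blast
  then have "S v = f" using \<kappa> by (simp add: g_def)
  then show ?thesis using that[of v] by (simp add: S f)
qed

text \<open>By Baire one of the closed sets \<open>S n\<close> contains a ball, and a bound on a
  ball rescales to the whole space. This turns the strong continuity of a Riccati solution into a
  bound of its operator norms on \<open>{0..T}\<close>.\<close>

lemma banach_steinhaus:
  fixes F :: "'i \<Rightarrow> 'a::{real_normed_vector,complete_space} \<Rightarrow>\<^sub>L 'b::real_normed_vector"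
  assumes bounded: "\<And>x. \<exists>C. \<forall>i\<in>I. norm (F i x) \<le> C"
  obtains C where "C \<ge> 0" "\<And>i. i \<in> I \<Longrightarrow> norm (F i) \<le> C"
proof -
  define S where "S n = (\<Inter>i\<in>I. {x. norm (F i x) \<le> real n})" for n :: nat
  have closed: "closed (S n)" for n
    unfolding S_def by (intro closed_INT ballI closed_Collect_le continuous_intros)
  have "(\<Union>n. S n) = UNIV"
  proof (intro set_eqI iffI)
    fix x
    obtain C where "\<forall>i\<in>I. norm (F i x) \<le> C" using bounded by blast
    moreover obtain n where "C \<le> real n" using real_arch_simple by blast
    ultimately have "\<forall>i\<in>I. norm (F i x) \<le> real n" by (meson order_trans)
    then show "x \<in> (\<Union>n. S n)" unfolding S_def by auto
  qed auto
  then have "interior (\<Union>(range S)) \<noteq> {}" by simp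
  moreover have "Met_TC.mcomplete TYPE('a)"
    by (simp add: complete_UNIV)
  ultimately have "\<exists>n. interior (S n) \<noteq> {}"
    using Met_TC.metric_Baire_category_alt[of "range S"] closed by auto
  then obtain n z e where e: "e > 0" "cball z e \<subseteq> S n"
    by (meson equals0I mem_interior_cball)
  \<comment> \<open>\<open>w = (z + w) - z\<close> with \<open>z + w\<close> and \<open>z\<close> in
    \<open>S n\<close> gives \<open>2 * real n\<close> on the sphere of radius
    \<open>e\<close>.\<close>
  show ?thesis
  proof (rule that[of "2 * real n / e"])
    fix i assume i: "i \<in> I"
    show "norm (F i) \<le> 2 * real n / e"
    proof (rule norm_blinfun_bound)
      fix x
      show "norm (F i x) \<le> 2 * real n / e * norm x"
      proof (cases "x = 0")
        case False
        define w where "w = (e / norm x) *\<^sub>R x"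
        have "norm w = e" using False e by (simp add: w_def)
        then have "z + w \<in> S n" "z \<in> S n" using e by (auto simp: dist_norm subset_iff)
        then have "norm (F i (z + w)) \<le> n" "norm (F i z) \<le> n" using i by (auto simp: S_def)
        moreover have "F i w = F i (z + w) - F i z" by (simp add: blinfun.add_right)
        ultimately have "norm (F i w) \<le> 2 * real n"
          using norm_triangle_ineq4[of "F i (z + w)" "F i z"] by simp
        then show ?thesis using False e by (simp add: w_def blinfun.scaleR_right field_simps)
      qed simp
    qed (use e in simp)
  qed (use e in simp)
qed

text \<open>At a positive maximum of \<open>exp (- (2 * b * s)) * u s\<close> the integral term
  amounts to at most half of that maximum, since the weight decays at twice the rate
  \<open>b\<close>. Absorbing this half produces the factor 2 and the doubled exponent.\<close>

lemma gronwall_bound: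
  fixes u :: "real \<Rightarrow> real"
  assumes T: "T \<ge> 0" and cont: "continuous_on {0..T} u" and b: "b > 0"
    and le: "\<And>t. t \<in> {0..T} \<Longrightarrow> u t \<le> a + b * integral {0..t} u"
    and t: "t \<in> {0..T}" and a: "a \<ge> 0"
  shows "u t \<le> 2 * a * exp (2 * b * T)"
proof -
  define v where "v s = exp (- (2 * b * s)) * u s" for s
  have "continuous_on {0..T} v" unfolding v_def by (intro continuous_intros cont)
  then obtain m where m: "m \<in> {0..T}" "\<And>s. s \<in> {0..T} \<Longrightarrow> v s \<le> v m"
    using continuous_attains_sup[of "{0..T}" v] T by auto
  have uv: "u s = exp (2 * b * s) * v s" for s by (simp add: v_def mult_exp_exp flip: mult.assoc)
  have "v m \<le> 2 * a"
  proof (cases "v m \<le> 0")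
    case False
    have "integral {0..m} u \<le> integral {0..m} (\<lambda>s. v m * exp (2 * b * s))"
    proof (intro integral_le)
      show "u integrable_on {0..m}"
        using m by (intro integrable_continuous_interval continuous_on_subset[OF cont]) auto
      show "(\<lambda>s. v m * exp (2 * b * s)) integrable_on {0..m}"
        by (intro integrable_continuous_interval continuous_intros)
    qed (use m in \<open>auto simp: uv mult.commute\<close>)
    also have "\<dots> = v m * (exp (2 * b * m) / (2 * b) - exp (2 * b * 0) / (2 * b))"
    proof (rule integral_unique)
      have "((\<lambda>s. exp (2 * b * s)) has_integral exp (2 * b * m) / (2 * b) - exp (2 * b * 0) / (2 * b)) {0..m}"
        using m b by (intro fundamental_theorem_of_calculus)
          (auto intro!: derivative_eq_intros simp: has_real_derivative_iff_has_vector_derivative[symmetric])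
      then show "((\<lambda>s. v m * exp (2 * b * s)) has_integral
          v m * (exp (2 * b * m) / (2 * b) - exp (2 * b * 0) / (2 * b))) {0..m}"
        by (rule has_integral_mult_right)
    qed
    also have "\<dots> \<le> v m * (exp (2 * b * m) / (2 * b))"
      using False b by (intro mult_left_mono) auto
    finally have "b * integral {0..m} u \<le> b * (v m * (exp (2 * b * m) / (2 * b)))"
      using b by (intro mult_left_mono) auto
    also have "\<dots> = exp (2 * b * m) * (v m / 2)" using b by (simp add: field_simps)
    finally have "exp (2 * b * m) * v m \<le> a + exp (2 * b * m) * (v m / 2)"
      using le[OF m(1)] unfolding uv[of m] by linarith
    moreover have "a \<le> exp (2 * b * m) * a" using a b m by (simp add: mult_le_cancel_right1)
    ultimately have "exp (2 * b * m) * v m \<le> exp (2 * b * m) * (a + v m / 2)"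
      by (simp add: distrib_left)
    then show ?thesis by simp
  qed (use a in simp)
  then have "v t \<le> 2 * a" using m(2)[OF t] by simp
  then have "u t \<le> exp (2 * b * t) * (2 * a)" by (simp add: uv)
  also have "\<dots> \<le> exp (2 * b * T) * (2 * a)"
    using t a b by (intro mult_right_mono) auto
  finally show ?thesis by (simp add: mult.commute)
qed

section \<open>Implicit Euler iterates of quasi-dissipative operators\<close>

text \<open>Operators are given by their graphs.\<close>

definition m_dissipative :: "real \<Rightarrow> ('a::real_inner \<times> 'a) set \<Rightarrow> bool" where
  "m_dissipative \<rho> G \<longleftrightarrow>
     0 \<le> \<rho> \<and> subspace G \<and> (\<forall>(x, y)\<in>G. x \<bullet> y \<le> \<rho> * (norm x)\<^sup>2) \<and>
     (\<forall>\<epsilon>>0. 2 * \<epsilon> * \<rho> \<le> 1 \<longrightarrow> (\<forall>z. \<exists>(x, y)\<in>G. x - \<epsilon> *\<^sub>R y = z)) \<and>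
     closure (fst ` G) = UNIV"

definition iterated_domain :: "('a \<times> 'a) set \<Rightarrow> 'a set" where
  "iterated_domain G = {x. \<exists>y z. (x, y) \<in> G \<and> (y, z) \<in> G}"

text \<open>Dissipativity gives the factor \<open>1 / (1 - \<epsilon> * \<rho>)\<close>. Its
  exponential majorant multiplies over \<open>j\<close> steps to
  \<open>exp (2 * \<rho> * (j * \<epsilon>))\<close>, which depends only on the elapsed time and not
  on the step size.\<close>

lemma resolvent_norm_le:
  assumes G: "m_dissipative \<rho> G" and xy: "(x, y) \<in> G" and \<epsilon>: "\<epsilon> > 0" "2 * \<epsilon> * \<rho> \<le> 1"
  shows "norm x \<le> exp (2 * \<rho> * \<epsilon>) * norm (x - \<epsilon> *\<^sub>R y)"
proof (cases "x = 0")
  case False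
  have \<rho>: "\<rho> \<ge> 0" and "x \<bullet> y \<le> \<rho> * (norm x)\<^sup>2" using G xy unfolding m_dissipative_def by auto
  then have "\<epsilon> * (x \<bullet> y) \<le> \<epsilon> * (\<rho> * (norm x)\<^sup>2)" using \<epsilon> by simp
  then have "norm x * ((1 - \<epsilon> * \<rho>) * norm x) \<le> x \<bullet> (x - \<epsilon> *\<^sub>R y)"
    by (simp add: inner_simps power2_norm_eq_inner[symmetric] algebra_simps power2_eq_square)
  also have "\<dots> \<le> norm x * norm (x - \<epsilon> *\<^sub>R y)" by (rule norm_cauchy_schwarz)
  finally have *: "(1 - \<epsilon> * \<rho>) * norm x \<le> norm (x - \<epsilon> *\<^sub>R y)" using False by simp
  define q where "q = \<epsilon> * \<rho>"
  have q: "0 \<le> q" "q \<le> 1/2" using \<epsilon> \<rho> by (auto simp: q_def mult_ac)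
  \<comment> \<open>Here the step size restriction enters: the product equals
    \<open>1 + q * (1 - 2 * q)\<close>.\<close>
  have "1 \<le> (1 + 2 * q) * (1 - q)" using q mult_nonneg_nonneg[of q "1 - 2 * q"] by (simp add: algebra_simps)
  also have "\<dots> \<le> exp (2 * q) * (1 - q)" using q by (intro mult_right_mono) auto
  finally have "norm x \<le> exp (2 * q) * (1 - q) * norm x" by (simp add: mult_le_cancel_right1)
  also have "\<dots> \<le> exp (2 * q) * norm (x - \<epsilon> *\<^sub>R y)"
    using * by (simp add: q_def mult.assoc)
  finally show ?thesis by (simp add: q_def mult_ac)
qed simp

text \<open>For \<open>x\<close> in the domain the resolvent \<open>x'\<close> of \<open>x\<close>
  lies in the domain of the square, and \<open>x' - x\<close> is the resolvent of
  \<open>\<epsilon> *\<^sub>R y\<close>, hence of order \<open>\<epsilon>\<close>.\<close>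

lemma closure_iterated_domain:
  assumes G: "m_dissipative \<rho> G"
  shows "closure (iterated_domain G) = UNIV"
proof -
  have sub: "subspace G" and \<rho>: "\<rho> \<ge> 0" using G by (auto simp: m_dissipative_def)
  have "x \<in> closure (iterated_domain G)" if x: "(x, y) \<in> G" for x y
    unfolding closure_approachable
  proof (intro allI impI)
    fix e :: real assume e: "e > 0"
    define \<epsilon> where "\<epsilon> = min (1 / (2 * \<rho> + 1)) (e / (2 * exp 1 * (norm y + 1)))"
    have \<epsilon>: "\<epsilon> > 0" using \<rho> e by (simp add: \<epsilon>_def add_pos_nonneg add_nonneg_pos)
    have "\<epsilon> * (2 * \<rho> + 1) \<le> 1" using \<rho> by (simp add: \<epsilon>_def pos_le_divide_eq[symmetric])
    then have \<epsilon>\<rho>: "2 * \<epsilon> * \<rho> \<le> 1" using \<epsilon> by (simp add: algebra_simps)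
    obtain x' y' where x': "(x', y') \<in> G" "x' - \<epsilon> *\<^sub>R y' = x"
      using G \<epsilon> \<epsilon>\<rho> unfolding m_dissipative_def by blast
    have "y' = (1 / \<epsilon>) *\<^sub>R (x' - x)" using x'(2) \<epsilon> by auto
    moreover have diff: "(x' - x, y' - y) \<in> G" using subspace_diff[OF sub x'(1) x] by simp
    then have "(1 / \<epsilon>) *\<^sub>R (x' - x, y' - y) \<in> G" using sub by (intro subspace_scale)
    ultimately have "x' \<in> iterated_domain G" using x' by (auto simp: iterated_domain_def)
    moreover have "dist x' x < e"
    proof -
      have "(x' - x) - \<epsilon> *\<^sub>R (y' - y) = \<epsilon> *\<^sub>R y" using x'(2) by (simp add: algebra_simps)
      then have "norm (x' - x) \<le> exp (2 * \<rho> * \<epsilon>) * (\<epsilon> * norm y)"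
        using resolvent_norm_le[OF G diff \<epsilon> \<epsilon>\<rho>] \<epsilon> by simp
      also have "\<dots> \<le> exp 1 * (\<epsilon> * norm y)"
        using \<epsilon>\<rho> \<epsilon> by (intro mult_right_mono) (auto simp: mult_ac)
      also have "\<dots> \<le> exp 1 * (\<epsilon> * (norm y + 1))" using \<epsilon> by simp
      also have "\<dots> \<le> e / 2"
      proof -
        have "0 < 2 * exp 1 * (norm y + 1)" by (simp add: add_nonneg_pos)
        moreover have "\<epsilon> \<le> e / (2 * exp 1 * (norm y + 1))" by (simp add: \<epsilon>_def)
        ultimately have "\<epsilon> * (2 * exp 1 * (norm y + 1)) \<le> e" by (simp only: pos_le_divide_eq)
        then show ?thesis by (simp add: mult_ac)
      qed
      finally show ?thesis using e by (simp add: dist_norm)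
    qed
    ultimately show "\<exists>w\<in>iterated_domain G. dist w x < e" by blast
  qed
  then have "fst ` G \<subseteq> closure (iterated_domain G)" by auto
  then have "closure (fst ` G) \<subseteq> closure (iterated_domain G)"
    by (rule closure_minimal) simp
  then show ?thesis using G by (auto simp: m_dissipative_def)
qed

text \<open>\<open>Y j\<close> and \<open>Z j\<close> are the first and second images of
  \<open>X j\<close> under the operator. They are carried through the recursion because the errors
  of the Euler scheme are measured by them.\<close>

lemma backward_euler:
  assumes G: "m_dissipative \<rho> G" and \<epsilon>: "\<epsilon> > 0" "2 * \<epsilon> * \<rho> \<le> 1"
    and x0: "(x, y) \<in> G" "(y, z) \<in> G"
  obtains X Y Z :: "nat \<Rightarrow> 'a::real_inner"
  where "X 0 = x" "\<And>j. (X j, Y j) \<in> G" "\<And>j. (Y j, Z j) \<in> G"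
    "\<And>j. X j = X (Suc j) - \<epsilon> *\<^sub>R Y (Suc j)"
    "\<And>j. norm (X j) \<le> exp (2 * \<rho> * (j * \<epsilon>)) * norm x"
    "\<And>j. norm (Y j) \<le> exp (2 * \<rho> * (j * \<epsilon>)) * norm y"
    "\<And>j. norm (Z j) \<le> exp (2 * \<rho> * (j * \<epsilon>)) * norm z"
proof -
  have sub: "subspace G" using G by (auto simp: m_dissipative_def)
  define P where "P = (\<lambda>(j::nat) (x', y', z'). (x', y') \<in> G \<and> (y', z') \<in> G \<and> (j = 0 \<longrightarrow> x' = x) \<and>
     norm x' \<le> exp (2 * \<rho> * (j * \<epsilon>)) * norm x \<and>
     norm y' \<le> exp (2 * \<rho> * (j * \<epsilon>)) * norm y \<and>
     norm z' \<le> exp (2 * \<rho> * (j * \<epsilon>)) * norm z)"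
  define R where "R = (\<lambda>(x', y'::'a, z'::'a) (x'', y'', z''::'a). x' = x'' - \<epsilon> *\<^sub>R (y''::'a))"
  have "\<exists>w. \<forall>j. P j (w j) \<and> (\<lambda>_::nat. R) j (w j) (w (Suc j))"
  proof (rule dependent_nat_choice)
    show "\<exists>w. P 0 w" using x0 by (intro exI[of _ "(x, y, z)"]) (simp add: P_def)
  next
    fix w j assume "P j w"
    then obtain x' y' z' where w: "w = (x', y', z')" and P: "P j (x', y', z')" by (cases w) auto
    then have mem: "(x', y') \<in> G" "(y', z') \<in> G" by (auto simp: P_def)
    \<comment> \<open>Only the top component is solved for. \<open>y''\<close> and
      \<open>x''\<close> are built up from \<open>z''\<close>, and since \<open>G\<close> is a
      subspace the new pairs lie in \<open>G\<close>; that resolvent and operator commute is thus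
      built in.\<close>
    obtain z'' v where z'': "(z'', v) \<in> G" "z'' - \<epsilon> *\<^sub>R v = z'"
      using G \<epsilon> unfolding m_dissipative_def by blast
    define y'' where "y'' = y' + \<epsilon> *\<^sub>R z''"
    define x'' where "x'' = x' + \<epsilon> *\<^sub>R y''"
    have "(y', z') + \<epsilon> *\<^sub>R (z'', v) \<in> G"
      using sub z''(1) mem by (intro subspace_add subspace_scale)
    then have y'': "(y'', z'') \<in> G" using z''(2) by (simp add: y''_def algebra_simps)
    have "(x', y') + \<epsilon> *\<^sub>R (y'', z'') \<in> G"
      using sub y'' mem by (intro subspace_add subspace_scale)
    then have x'': "(x'', y'') \<in> G" by (simp add: x''_def y''_def)
    have step: "norm p \<le> exp (2 * \<rho> * (Suc j * \<epsilon>)) * C"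
      if "norm p \<le> exp (2 * \<rho> * \<epsilon>) * norm p'" "norm p' \<le> exp (2 * \<rho> * (j * \<epsilon>)) * C" for p p' :: 'a and C
    proof -
      have "norm p \<le> exp (2 * \<rho> * \<epsilon>) * (exp (2 * \<rho> * (j * \<epsilon>)) * C)"
        using that by (meson exp_ge_zero mult_left_mono order_trans)
      then show ?thesis by (simp add: algebra_simps exp_add)
    qed
    have "norm x'' \<le> exp (2 * \<rho> * \<epsilon>) * norm x'"
      using resolvent_norm_le[OF G x'' \<epsilon>] by (simp add: x''_def)
    moreover have "norm y'' \<le> exp (2 * \<rho> * \<epsilon>) * norm y'"
      using resolvent_norm_le[OF G y'' \<epsilon>] by (simp add: y''_def)
    moreover have "norm z'' \<le> exp (2 * \<rho> * \<epsilon>) * norm z'"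
      using resolvent_norm_le[OF G z''(1) \<epsilon>] z''(2) by simp
    ultimately have "P (Suc j) (x'', y'', z'')"
      using P x'' y'' step unfolding P_def by (auto simp del: of_nat_Suc)
    moreover have "R w (x'', y'', z'')" by (simp add: R_def w x''_def)
    ultimately show "\<exists>w'. P (Suc j) w' \<and> R w w'" by blast
  qed
  then obtain w where w: "\<And>j. P j (w j)" "\<And>j. R (w j) (w (Suc j))" by blast
  show ?thesis
  proof (rule that[of "\<lambda>j. fst (w j)" "\<lambda>j. fst (snd (w j))" "\<lambda>j. snd (snd (w j))"])
    show "fst (w 0) = x" using w(1)[of 0] by (auto simp: P_def split: prod.splits)
    show "fst (w j) = fst (w (Suc j)) - \<epsilon> *\<^sub>R fst (snd (w (Suc j)))" for j
      using w(2)[of j] unfolding R_def split_beta .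
  qed (use w(1) in \<open>simp_all add: P_def split_beta\<close>)
qed

section \<open>A priori bounds by testing along Euler iterates\<close>

lemma dense_le:
  fixes f g :: "'a::topological_space \<Rightarrow> real"
  assumes S: "closure S = UNIV" and f: "continuous_on UNIV f" and g: "continuous_on UNIV g"
    and le: "\<And>x. x \<in> S \<Longrightarrow> f x \<le> g x"
  shows "f x \<le> g x"
proof -
  have "closure S \<subseteq> {x. f x \<le> g x}"
    using le by (intro closure_minimal closed_Collect_le f g) auto
  then show ?thesis using S by auto
qed

text \<open>\<open>incr\<close> is the weak equation integrated over a step, with \<open>c\<close>
  bounding the unbounded term there and \<open>\<Gamma>\<close> a primitive of a bound of the
  forcing. Since \<open>e\<close> is paired with the images \<open>w'\<close>, the intended
  \<open>G\<close> is the graph of the adjoint.\<close>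

lemma evolution_bound:
  fixes e :: "real \<Rightarrow> 'a::real_inner"
  assumes G: "m_dissipative \<rho> G" and e: "continuous_on {0..T} e"
    and \<Gamma>: "\<And>s t. 0 \<le> s \<Longrightarrow> s \<le> t \<Longrightarrow> t \<le> T \<Longrightarrow> \<Gamma> s \<le> \<Gamma> t"
    and incr: "\<And>w w' s t c. (w, w') \<in> G \<Longrightarrow> 0 \<le> s \<Longrightarrow> s \<le> t \<Longrightarrow> t \<le> T \<Longrightarrow>
        (\<And>r. r \<in> {s..t} \<Longrightarrow> e r \<bullet> w' \<le> c) \<Longrightarrow>
        (e t - e s) \<bullet> w \<le> (t - s) * c + norm w * (\<Gamma> t - \<Gamma> s)"
    and t: "t \<in> {0..T}"
  shows "norm (e t) \<le> exp (2 * \<rho> * T) * (norm (e 0) + (\<Gamma> t - \<Gamma> 0))"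
proof -
  have \<rho>: "\<rho> \<ge> 0" using G by (simp add: m_dissipative_def)
  have tested: "e t \<bullet> x \<le> exp (2 * \<rho> * T) * norm x * (norm (e 0) + (\<Gamma> t - \<Gamma> 0))"
    if x: "x \<in> iterated_domain G" for x
  proof -
    obtain y z where xyz: "(x, y) \<in> G" "(y, z) \<in> G" using x by (auto simp: iterated_domain_def)
    define D where "D = exp (2 * \<rho> * T)"
    have D: "1 \<le> D" using \<rho> t by (auto simp: D_def)
    have small: "e t \<bullet> x \<le> D * norm x * (norm (e 0) + (\<Gamma> t - \<Gamma> 0)) + \<omega> * (T * (D * norm y))"
      if \<omega>: "\<omega> > 0" for \<omega>
    proof -
      have "uniformly_continuous_on {0..T} e"
        using e by (intro compact_uniformly_continuous) auto
      then obtain d where d: "d > 0"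
        "\<And>r r'. r \<in> {0..T} \<Longrightarrow> r' \<in> {0..T} \<Longrightarrow> dist r' r < d \<Longrightarrow> dist (e r') (e r) < \<omega>"
        using \<omega> unfolding uniformly_continuous_on_def by metis
      show ?thesis
      proof (cases "t = 0")
        case True
        have "e t \<bullet> x \<le> norm (e 0) * norm x" using True norm_cauchy_schwarz by simp
        also have "\<dots> \<le> norm (e 0) * norm x * D"
          using mult_left_mono[OF D, of "norm (e 0) * norm x"] by simp
        finally show ?thesis using \<omega> t by (simp add: True D_def mult_ac add_increasing2)
      next
        case False
        then have "t > 0" using t by simp
        \<comment> \<open>Large enough to bring the step \<open>t / n\<close> below the modulus of
          continuity \<open>d\<close> and to ensure
          \<open>2 * \<epsilon> * \<rho> \<le> 1\<close>.\<close>
        obtain n :: nat where n: "real n > t / d + 2 * t * \<rho> + 1" using reals_Archimedean2 by blast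
        have n0: "real n > 0" using n \<open>t > 0\<close> d(1) \<rho> by (smt (verit) divide_pos_pos mult_nonneg_nonneg)
        define \<epsilon> where "\<epsilon> = t / n"
        have \<epsilon>: "\<epsilon> > 0" and n\<epsilon>: "real n * \<epsilon> = t" using \<open>t > 0\<close> n0 by (auto simp: \<epsilon>_def)
        have "t / d < n" using n \<open>t > 0\<close> \<rho> by (smt (verit) mult_nonneg_nonneg)
        then have \<epsilon>d: "\<epsilon> < d" using d(1) n0 by (simp add: \<epsilon>_def field_simps)
        have "2 * t * \<rho> \<le> n" using n \<open>t > 0\<close> d(1) by (smt (verit) divide_pos_pos)
        then have \<epsilon>\<rho>: "2 * \<epsilon> * \<rho> \<le> 1" using n0 by (simp add: \<epsilon>_def field_simps)
        obtain X Y Z :: "nat \<Rightarrow> 'a" where XY: "X 0 = x" "\<And>j. (X j, Y j) \<in> G"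
            "\<And>j. X j = X (Suc j) - \<epsilon> *\<^sub>R Y (Suc j)"
          and XY_norm: "\<And>j. norm (X j) \<le> exp (2 * \<rho> * (j * \<epsilon>)) * norm x"
            "\<And>j. norm (Y j) \<le> exp (2 * \<rho> * (j * \<epsilon>)) * norm y"
          using backward_euler[OF G \<epsilon> \<epsilon>\<rho> xyz] by metis
        have XYD: "norm (X j) \<le> D * norm x" "norm (Y j) \<le> D * norm y" if "j \<le> n" for j
        proof -
          have "real j * \<epsilon> \<le> n * \<epsilon>" using that \<epsilon> by simp
          then have "real j * \<epsilon> \<le> T" using n\<epsilon> t by simp
          then have le: "exp (2 * \<rho> * (j * \<epsilon>)) \<le> D" using \<rho> unfolding D_def by (simp add: mult_left_mono)
          then show "norm (X j) \<le> D * norm x" "norm (Y j) \<le> D * norm y"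
            using XY_norm[of j] le[THEN mult_right_mono, of "norm x"] le[THEN mult_right_mono, of "norm y"]
              le[THEN mult_right_mono, of "norm z"] by simp_all
        qed
        define tm where "tm j = t - real j * \<epsilon>" for j
        \<comment> \<open>Time runs backward as \<open>j\<close> grows. The contribution
          \<open>\<epsilon> * (e (tm j) \<bullet> Y (Suc j))\<close> of the increment of
          \<open>e\<close> is removed by passing from \<open>X (Suc j)\<close> to
          \<open>X j\<close>; only the forcing and the error of freezing \<open>e\<close>
          remain.\<close>
        have "e t \<bullet> x \<le> e (tm j) \<bullet> X j + real j * (\<epsilon> * (\<omega> * (D * norm y))) + D * norm x * (\<Gamma> t - \<Gamma> (tm j))"
          if "j \<le> n" for j
          using that
        proof (induction j)
          case (Suc j)
          have "real (Suc j) * \<epsilon> \<le> n * \<epsilon>" using Suc.prems \<epsilon> by (intro mult_right_mono) auto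
          moreover have "0 \<le> real j * \<epsilon>" using \<epsilon> by simp
          ultimately have tm: "0 \<le> tm (Suc j)" "tm (Suc j) \<le> tm j" "tm j \<le> T" "tm j - tm (Suc j) = \<epsilon>"
            using n\<epsilon> t \<epsilon> unfolding tm_def of_nat_Suc distrib_right atLeastAtMost_iff by linarith+
          have "(e (tm j) - e (tm (Suc j))) \<bullet> X (Suc j)
              \<le> (tm j - tm (Suc j)) * (e (tm j) \<bullet> Y (Suc j) + \<omega> * norm (Y (Suc j)))
                + norm (X (Suc j)) * (\<Gamma> (tm j) - \<Gamma> (tm (Suc j)))"
          proof (rule incr)
            show "(X (Suc j), Y (Suc j)) \<in> G" by (rule XY)
            fix r assume r: "r \<in> {tm (Suc j)..tm j}"
            then have "dist (e r) (e (tm j)) < \<omega>"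
              using tm \<epsilon>d by (intro d) (auto simp: dist_real_def)
            then have "norm (e r - e (tm j)) * norm (Y (Suc j)) \<le> \<omega> * norm (Y (Suc j))"
              by (intro mult_right_mono) (auto simp: dist_norm)
            then show "e r \<bullet> Y (Suc j) \<le> e (tm j) \<bullet> Y (Suc j) + \<omega> * norm (Y (Suc j))"
              using norm_cauchy_schwarz[of "e r - e (tm j)" "Y (Suc j)"] by (simp add: inner_diff_left)
          qed (use tm in auto)
          moreover have "e (tm j) \<bullet> X j = e (tm j) \<bullet> X (Suc j) - \<epsilon> * (e (tm j) \<bullet> Y (Suc j))"
            by (subst XY(3)) (simp add: inner_diff_right)
          moreover have "\<epsilon> * (\<omega> * norm (Y (Suc j))) \<le> \<epsilon> * (\<omega> * (D * norm y))"
            using XYD(2)[OF Suc.prems] \<epsilon> \<omega> by (intro mult_left_mono) auto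
          moreover have "norm (X (Suc j)) * (\<Gamma> (tm j) - \<Gamma> (tm (Suc j)))
              \<le> D * norm x * (\<Gamma> (tm j) - \<Gamma> (tm (Suc j)))"
            using XYD(1)[OF Suc.prems] \<Gamma>[of "tm (Suc j)" "tm j"] tm by (intro mult_right_mono) auto
          ultimately show ?case
            using Suc tm(4) by (simp add: algebra_simps)
        qed (simp add: XY(1) tm_def)
        from this[of n] have "e t \<bullet> x \<le> e 0 \<bullet> X n + t * (\<omega> * (D * norm y)) + D * norm x * (\<Gamma> t - \<Gamma> 0)"
          using n\<epsilon> by (simp add: tm_def flip: mult.assoc)
        moreover have "e 0 \<bullet> X n \<le> norm (e 0) * (D * norm x)"
          using norm_cauchy_schwarz[of "e 0" "X n"] mult_left_mono[OF XYD(1)[of n], of "norm (e 0)"]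
          by simp
        moreover have "t * (\<omega> * (D * norm y)) \<le> T * (\<omega> * (D * norm y))"
          using t \<omega> by (intro mult_right_mono) (auto simp: D_def)
        ultimately show ?thesis by (simp add: algebra_simps)
      qed
    qed
    show ?thesis
    proof (rule field_le_epsilon)
      fix \<eta> :: real assume \<eta>: "\<eta> > 0"
      define k where "k = T * (D * norm y) + 1"
      have k: "k > 0" using t by (auto simp: k_def D_def intro!: add_nonneg_pos)
      have "\<eta> / k * (T * (D * norm y)) \<le> \<eta> / k * k"
        using \<eta> k by (intro mult_left_mono) (auto simp: k_def)
      then show "e t \<bullet> x \<le> exp (2 * \<rho> * T) * norm x * (norm (e 0) + (\<Gamma> t - \<Gamma> 0)) + \<eta>"
        using small[of "\<eta> / k"] \<eta> k by (simp add: D_def)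
    qed
  qed
  \<comment> \<open>With the term in \<open>norm y\<close> gone, both sides are continuous in
    \<open>x\<close> and density applies.\<close>
  have "e t \<bullet> x \<le> exp (2 * \<rho> * T) * norm x * (norm (e 0) + (\<Gamma> t - \<Gamma> 0))" for x
    by (rule dense_le[OF closure_iterated_domain[OF G] _ _ tested]) (intro continuous_intros)+
  from this[of "e t"] have "norm (e t) * norm (e t)
      \<le> norm (e t) * (exp (2 * \<rho> * T) * (norm (e 0) + (\<Gamma> t - \<Gamma> 0)))"
    by (simp add: dot_square_norm power2_eq_square mult_ac)
  then show ?thesis
    using t \<Gamma>[of 0 t] by (cases "e t = 0") (auto intro!: mult_nonneg_nonneg add_nonneg_nonneg)
qed

text \<open>\<open>K\<close> and \<open>L\<close> are absent from the conclusion because they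
  control only errors that vanish with the step size. \<open>incr\<close> is one-sided: it carries
  no quadratic term in \<open>Pm\<close>, which could only lower the form.\<close>

lemma riccati_bound:
  fixes Pm :: "real \<Rightarrow> 'a::real_inner \<Rightarrow>\<^sub>L 'a"
  assumes G: "m_dissipative \<rho> G" and q: "q \<ge> 0" and p: "p \<ge> 0" and K: "K \<ge> 0" and L: "L \<ge> 0"
    and norm_le: "\<And>t. t \<in> {0..T} \<Longrightarrow> norm (Pm t) \<le> K"
    and sym: "\<And>t x z. t \<in> {0..T} \<Longrightarrow> Pm t x \<bullet> z = x \<bullet> Pm t z"
    and init: "\<And>x. Pm 0 x \<bullet> x \<le> p * (norm x)\<^sup>2"
    and lipschitz: "\<And>x x' z z' s t. (x, x') \<in> G \<Longrightarrow> (z, z') \<in> G \<Longrightarrow> 0 \<le> s \<Longrightarrow> s \<le> t \<Longrightarrow> t \<le> T \<Longrightarrow>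
      \<bar>Pm t x \<bullet> z - Pm s x \<bullet> z\<bar> \<le> L * (norm x + norm x') * (norm z + norm z') * (t - s)"
    and incr: "\<And>x x' s t c. (x, x') \<in> G \<Longrightarrow> 0 \<le> s \<Longrightarrow> s \<le> t \<Longrightarrow> t \<le> T \<Longrightarrow>
      (\<And>r. r \<in> {s..t} \<Longrightarrow> 2 * (Pm r x \<bullet> x') \<le> c) \<Longrightarrow>
      Pm t x \<bullet> x - Pm s x \<bullet> x \<le> (t - s) * (c + q * (norm x)\<^sup>2)"
    and t: "t \<in> {0..T}"
  shows "Pm t x \<bullet> x \<le> (exp (2 * \<rho> * T))\<^sup>2 * (p + T * q) * (norm x)\<^sup>2"
proof -
  have \<rho>: "\<rho> \<ge> 0" using G by (simp add: m_dissipative_def)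
  define D where "D = exp (2 * \<rho> * T)"
  have D: "D \<ge> 1" using \<rho> t by (auto simp: D_def)
  have tested: "Pm t x \<bullet> x \<le> D\<^sup>2 * (p + T * q) * (norm x)\<^sup>2"
    if x: "x \<in> iterated_domain G" for x
  proof (cases "t = 0")
    case True
    have "p * 1 \<le> (p + T * q) * D\<^sup>2" using D p q t by (intro mult_mono) auto
    then have "p * (norm x)\<^sup>2 \<le> D\<^sup>2 * (p + T * q) * (norm x)\<^sup>2"
      by (intro mult_right_mono) (auto simp: mult.commute)
    then show ?thesis using init[of x] by (simp add: True)
  next
    case False
    then have "t > 0" using t by simp
    obtain y z where xyz: "(x, y) \<in> G" "(y, z) \<in> G" using x by (auto simp: iterated_domain_def)
    \<comment> \<open>Twice the Lipschitz error of replacing \<open>Pm r\<close> by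
      \<open>Pm s\<close> in the unbounded term, plus a bound of
      \<open>Pm s (Y (Suc j)) \<bullet> Y (Suc j)\<close> from expanding the form at
      \<open>X j\<close>. Both occur with \<open>\<epsilon>\<^sup>2\<close>, so \<open>n\<close>
      steps leave \<open>t * c * (t / n)\<close>.\<close>
    define c where "c = 2 * (L * (D * norm x + D * norm y) * (D * norm y + D * norm z)) + K * (D * norm y)\<^sup>2"
    have c: "c \<ge> 0" using K L D by (simp add: c_def)
    have euler: "Pm t x \<bullet> x \<le> D\<^sup>2 * (p + T * q) * (norm x)\<^sup>2 + t * c * (t / n)"
      if n: "real n \<ge> 2 * t * \<rho>" "n > 0" for n :: nat
    proof -
      define \<epsilon> where "\<epsilon> = t / n"
      have \<epsilon>: "\<epsilon> > 0" and n\<epsilon>: "real n * \<epsilon> = t" using \<open>t > 0\<close> n by (auto simp: \<epsilon>_def)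
      have \<epsilon>\<rho>: "2 * \<epsilon> * \<rho> \<le> 1" using n by (simp add: \<epsilon>_def field_simps)
      obtain X Y Z :: "nat \<Rightarrow> 'a" where XY: "X 0 = x" "\<And>j. (X j, Y j) \<in> G" "\<And>j. (Y j, Z j) \<in> G"
          "\<And>j. X j = X (Suc j) - \<epsilon> *\<^sub>R Y (Suc j)"
        and XY_norm: "\<And>j. norm (X j) \<le> exp (2 * \<rho> * (j * \<epsilon>)) * norm x"
          "\<And>j. norm (Y j) \<le> exp (2 * \<rho> * (j * \<epsilon>)) * norm y"
          "\<And>j. norm (Z j) \<le> exp (2 * \<rho> * (j * \<epsilon>)) * norm z"
        using backward_euler[OF G \<epsilon> \<epsilon>\<rho> xyz] by metis
      have XYD: "norm (X j) \<le> D * norm x" "norm (Y j) \<le> D * norm y" "norm (Z j) \<le> D * norm z"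
        if "j \<le> n" for j
      proof -
        have "real j * \<epsilon> \<le> n * \<epsilon>" using that \<epsilon> by simp
        then have "real j * \<epsilon> \<le> T" using n\<epsilon> t by simp
        then have le: "exp (2 * \<rho> * (j * \<epsilon>)) \<le> D" using \<rho> unfolding D_def by (simp add: mult_left_mono)
        then show "norm (X j) \<le> D * norm x" "norm (Y j) \<le> D * norm y" "norm (Z j) \<le> D * norm z"
          using XY_norm[of j] le[THEN mult_right_mono, of "norm x"] le[THEN mult_right_mono, of "norm y"]
              le[THEN mult_right_mono, of "norm z"] by simp_all
      qed
      define tm where "tm j = t - real j * \<epsilon>" for j
      have "Pm t x \<bullet> x \<le> Pm (tm j) (X j) \<bullet> X j + real j * (\<epsilon> * (q * (D * norm x)\<^sup>2 + c * \<epsilon>))"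
        if "j \<le> n" for j
        using that
      proof (induction j)
        case (Suc j)
        define s where "s = tm j"
        define s' where "s' = tm (Suc j)"
        define u where "u = X (Suc j)"
        define v where "v = Y (Suc j)"
        define l where "l = L * (norm u + norm v) * (norm v + norm (Z (Suc j)))"
        have uv: "(u, v) \<in> G" "(v, Z (Suc j)) \<in> G" by (simp_all add: u_def v_def XY(2,3))
        have "real (Suc j) * \<epsilon> \<le> n * \<epsilon>" using Suc.prems \<epsilon> by (intro mult_right_mono) auto
        moreover have "0 \<le> real j * \<epsilon>" using \<epsilon> by simp
        ultimately have tm: "0 \<le> s'" "s' \<le> s" "s \<le> T" "s - s' = \<epsilon>"
          using n\<epsilon> t \<epsilon> unfolding tm_def s_def s'_def of_nat_Suc distrib_right atLeastAtMost_iff by linarith+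
        then have sT: "s \<in> {0..T}" by auto
        have "Pm s u \<bullet> u - Pm s' u \<bullet> u \<le> (s - s') * (2 * (Pm s u \<bullet> v) + 2 * l * \<epsilon> + q * (norm u)\<^sup>2)"
        proof (rule incr[OF uv(1)])
          fix r assume r: "r \<in> {s'..s}"
          have l: "l \<ge> 0" using L by (simp add: l_def)
          have "\<bar>Pm s u \<bullet> v - Pm r u \<bullet> v\<bar> \<le> l * (s - r)"
            unfolding l_def using r tm by (intro lipschitz uv) auto
          also have "\<dots> \<le> l * \<epsilon>" using r tm l by (intro mult_left_mono) auto
          finally show "2 * (Pm r u \<bullet> v) \<le> 2 * (Pm s u \<bullet> v) + 2 * l * \<epsilon>" by (simp add: abs_le_iff)
        qed (use tm in auto)
        \<comment> \<open>The cross term cancels the contribution of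
          \<open>2 * (Pm s u \<bullet> v)\<close> in the increment.\<close>
        moreover have "Pm s (X j) \<bullet> X j = Pm s u \<bullet> u - 2 * \<epsilon> * (Pm s u \<bullet> v) + \<epsilon> * \<epsilon> * (Pm s v \<bullet> v)"
        proof -
          have "Pm s v \<bullet> u = Pm s u \<bullet> v" using sym[OF sT, of v u] by (simp add: inner_commute)
          moreover have "X j = u - \<epsilon> *\<^sub>R v" unfolding u_def v_def by (rule XY)
          ultimately show ?thesis
            by (simp only: blinfun.diff_right blinfun.scaleR_right inner_diff_left inner_diff_right
                inner_scaleR_left inner_scaleR_right) (simp add: algebra_simps)
        qed
        moreover have "\<epsilon> * (q * (norm u)\<^sup>2) \<le> \<epsilon> * (q * (D * norm x)\<^sup>2)"
          using XYD(1)[OF Suc.prems] \<epsilon> q by (intro mult_left_mono power_mono) (auto simp: u_def)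
        moreover have "\<epsilon> * (\<epsilon> * (2 * l + Pm s v \<bullet> v)) \<le> \<epsilon> * (\<epsilon> * c)"
        proof (intro mult_left_mono)
          have "Pm s v \<bullet> v \<le> norm (Pm s v) * norm v" by (rule norm_cauchy_schwarz)
          also have "\<dots> \<le> norm (Pm s) * norm v * norm v" by (intro mult_right_mono norm_blinfun) auto
          also have "\<dots> \<le> K * (D * norm y) * (D * norm y)"
            using XYD(2)[OF Suc.prems] norm_le[OF sT] K D by (intro mult_mono) (auto simp: v_def)
          finally have "Pm s v \<bullet> v \<le> K * (D * norm y)\<^sup>2" by (simp add: power2_eq_square mult_ac)
          moreover have "l \<le> L * (D * norm x + D * norm y) * (D * norm y + D * norm z)"
            unfolding l_def u_def v_def using XYD[OF Suc.prems] L D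
            by (intro mult_mono add_mono mult_nonneg_nonneg add_nonneg_nonneg) auto
          ultimately show "2 * l + Pm s v \<bullet> v \<le> c" by (simp add: c_def)
        qed (use \<epsilon> in auto)
        ultimately have "Pm s (X j) \<bullet> X j \<le> Pm s' u \<bullet> u + \<epsilon> * (q * (D * norm x)\<^sup>2 + c * \<epsilon>)"
          unfolding tm(4) by (simp add: algebra_simps)
        moreover have "Pm t x \<bullet> x \<le> Pm s (X j) \<bullet> X j + real j * (\<epsilon> * (q * (D * norm x)\<^sup>2 + c * \<epsilon>))"
          using Suc by (simp add: s_def)
        ultimately show ?case unfolding u_def s'_def by (simp add: algebra_simps)
      qed (simp add: XY(1) tm_def)
      from this[of n] have "Pm t x \<bullet> x \<le> Pm 0 (X n) \<bullet> X n + t * (q * (D * norm x)\<^sup>2 + c * \<epsilon>)"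
        using n\<epsilon> by (simp add: tm_def flip: mult.assoc)
      also have "Pm 0 (X n) \<bullet> X n \<le> p * (D * norm x)\<^sup>2"
      proof -
        have "p * (norm (X n))\<^sup>2 \<le> p * (D * norm x)\<^sup>2"
          using XYD(1)[of n] p by (intro mult_left_mono power_mono) auto
        then show ?thesis using init[of "X n"] by linarith
      qed
      also have "t * (q * (D * norm x)\<^sup>2 + c * \<epsilon>) = t * (q * (D * norm x)\<^sup>2) + t * c * (t / n)"
        by (simp add: \<epsilon>_def algebra_simps)
      also have "t * (q * (D * norm x)\<^sup>2) \<le> T * (q * (D * norm x)\<^sup>2)"
        using t q by (intro mult_right_mono) auto
      finally show ?thesis by (simp add: algebra_simps power_mult_distrib)
    qed
    have "(\<lambda>n. D\<^sup>2 * (p + T * q) * (norm x)\<^sup>2 + t * c * (t / real n))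
        \<longlonglongrightarrow> D\<^sup>2 * (p + T * q) * (norm x)\<^sup>2 + t * c * 0"
      by (intro tendsto_intros lim_const_over_n)
    moreover have "\<forall>\<^sub>F n in sequentially. Pm t x \<bullet> x \<le> D\<^sup>2 * (p + T * q) * (norm x)\<^sup>2 + t * c * (t / real n)"
      using eventually_ge_at_top[of "nat \<lceil>2 * t * \<rho>\<rceil>"] eventually_gt_at_top[of 0]
      by eventually_elim (intro euler, linarith, simp)
    ultimately have "Pm t x \<bullet> x \<le> D\<^sup>2 * (p + T * q) * (norm x)\<^sup>2 + t * c * 0"
      by (intro tendsto_lowerbound[OF _ _ sequentially_bot])
    then show ?thesis by simp
  qed
  show ?thesis
    by (rule dense_le[OF closure_iterated_domain[OF G] _ _ tested[unfolded D_def]])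
      (intro continuous_intros)+
qed

text \<open>\<open>riccati_bound\<close> controls only the quadratic form, while the feedback needs
  the vector \<open>Pm t x\<close>; for symmetric nonnegative operators the same constant
  serves.\<close>

lemma norm_le_of_quadratic_form:
  fixes F :: "'a::real_inner \<Rightarrow>\<^sub>L 'a"
  assumes sym: "\<And>x z. F x \<bullet> z = x \<bullet> F z" and nonneg: "\<And>x. F x \<bullet> x \<ge> 0"
    and le: "\<And>x. F x \<bullet> x \<le> C * (norm x)\<^sup>2" and C: "C \<ge> 0"
  shows "norm (F x) \<le> C * norm x"
proof (cases "x = 0 \<or> F x = 0")
  case False
  define r where "r = norm x / norm (F x)"
  define z where "z = r *\<^sub>R F x"
  have z: "norm z = norm x" using False by (simp add: z_def r_def)
  \<comment> \<open>polarization: 4 F(x,z) = F(x+z,x+z) - F(x-z,x-z), with z the multiple of F x of norm |x|\<close>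
  have "F z \<bullet> x = F x \<bullet> z" using sym[of z x] by (simp add: inner_commute)
  then have "4 * (F x \<bullet> z) = F (x + z) \<bullet> (x + z) - F (x - z) \<bullet> (x - z)"
    by (simp add: blinfun.add_right blinfun.diff_right inner_simps)
  also have "\<dots> \<le> C * (norm (x + z))\<^sup>2 + C * (norm (x - z))\<^sup>2"
  proof -
    have "0 \<le> C * (norm (x - z))\<^sup>2" using C by simp
    then show ?thesis using le[of "x + z"] nonneg[of "x - z"] by linarith
  qed
  also have "\<dots> = C * (4 * (norm x)\<^sup>2)"
    unfolding z[symmetric] distrib_left[symmetric] power2_norm_eq_inner using z
    by (simp add: inner_simps inner_commute norm_eq_sqrt_inner)
  finally have "F x \<bullet> z \<le> C * (norm x)\<^sup>2" by simp
  moreover have "F x \<bullet> z = norm x * norm (F x)"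
    using False by (simp add: z_def r_def dot_square_norm power2_eq_square)
  ultimately have "norm x * norm (F x) \<le> norm x * (C * norm x)"
    by (simp add: power2_eq_square mult_ac)
  then show ?thesis using False by simp
qed (use C in auto)

section \<open>Operators induced by bilinear forms\<close>

text \<open>The part in H of the operator induced by \<open>a\<close>. With
  \<open>a v w = Op v w\<close> it is A on D(A), used for the Riccati equation; with the arguments
  exchanged it is the adjoint, used for evolution equations.\<close>

definition generator :: "('v::real_inner \<Rightarrow>\<^sub>L 'h::real_inner) \<Rightarrow> ('v \<Rightarrow> 'v \<Rightarrow> real) \<Rightarrow> ('h \<times> 'h) set" where
  "generator \<iota> a = {(\<iota> v, h) | v h. \<forall>w. a v w = h \<bullet> \<iota> w}"

text \<open>Resolvents come from Lax-Milgram for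
  \<open>\<iota> v \<bullet> \<iota> w - \<epsilon> * a v w\<close>, which is coercive with constant
  \<open>\<epsilon> * \<theta>\<close>. The domain is dense because the resolvents of
  \<open>\<iota> w\<close> tend to \<open>\<iota> w\<close> as \<open>\<epsilon>\<close> tends to
  0.\<close>

lemma m_dissipative_generator:
  fixes \<iota> :: "'v::{real_inner,complete_space} \<Rightarrow>\<^sub>L 'h::real_inner"
  assumes dense: "closure (range \<iota>) = UNIV" and a: "bounded_bilinear a"
    and \<theta>: "\<theta> > 0" and \<rho>: "\<rho> \<ge> 0"
    and garding: "\<And>v. \<theta> * (norm v)\<^sup>2 \<le> - a v v + \<rho> * (norm (\<iota> v))\<^sup>2"
  shows "m_dissipative \<rho> (generator \<iota> a)"
proof -
  interpret a: bounded_bilinear a by fact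
  have sub: "subspace (generator \<iota> a)"
  proof (rule subspaceI)
    show "0 \<in> generator \<iota> a"
      by (auto simp: generator_def zero_prod_def a.zero_left blinfun.zero_right intro!: exI[of _ 0])
  next
    fix p q assume "p \<in> generator \<iota> a" "q \<in> generator \<iota> a"
    then obtain v h v' h' where "p = (\<iota> v, h)" "\<forall>w. a v w = h \<bullet> \<iota> w"
        "q = (\<iota> v', h')" "\<forall>w. a v' w = h' \<bullet> \<iota> w"
      by (auto simp: generator_def)
    then show "p + q \<in> generator \<iota> a"
      by (auto simp: generator_def a.add_left inner_add_left blinfun.add_right intro!: exI[of _ "v + v'"])
  next
    fix c p assume "p \<in> generator \<iota> a"
    then obtain v h where "p = (\<iota> v, h)" "\<forall>w. a v w = h \<bullet> \<iota> w" by (auto simp: generator_def)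
    then show "c *\<^sub>R p \<in> generator \<iota> a"
      by (auto simp: generator_def a.scaleR_left blinfun.scaleR_right intro!: exI[of _ "c *\<^sub>R v"])
  qed
  have diss: "x \<bullet> y \<le> \<rho> * (norm x)\<^sup>2" if xy: "(x, y) \<in> generator \<iota> a" for x y
  proof -
    obtain v where v: "x = \<iota> v" "\<forall>w. a v w = y \<bullet> \<iota> w" using xy by (auto simp: generator_def)
    have "0 \<le> \<theta> * (norm v)\<^sup>2" using \<theta> by simp
    then show ?thesis using garding[of v] v by (simp add: inner_commute)
  qed
  have resolvent: "\<exists>v h. (\<forall>w. a v w = h \<bullet> \<iota> w) \<and> \<iota> v - \<epsilon> *\<^sub>R h = z"
    if \<epsilon>: "\<epsilon> > 0" "2 * \<epsilon> * \<rho> \<le> 1" for \<epsilon> z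
  proof -
    define c where "c v w = \<iota> v \<bullet> \<iota> w - \<epsilon> * a v w" for v w
    obtain M where M: "\<And>v w. norm (a v w) \<le> norm v * norm w * M" using a.bounded by blast
    have "bounded_bilinear c"
    proof
      have "norm (c v w) \<le> norm v * norm w * (norm \<iota> * norm \<iota> + \<epsilon> * M)" for v w
      proof -
        have "norm (\<iota> v \<bullet> \<iota> w) \<le> (norm \<iota> * norm v) * (norm \<iota> * norm w)"
          using Cauchy_Schwarz_ineq2[of "\<iota> v" "\<iota> w"]
          by (simp, elim order_trans, intro mult_mono norm_blinfun) auto
        moreover have "norm (\<epsilon> * a v w) \<le> \<epsilon> * (norm v * norm w * M)"
          using M[of v w] \<epsilon> by (simp add: abs_mult)
        ultimately show ?thesis
          unfolding c_def by (intro norm_triangle_le_diff) (simp add: algebra_simps)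
      qed
      then show "\<exists>K. \<forall>v w. norm (c v w) \<le> norm v * norm w * K" by blast
    qed (auto simp: c_def blinfun.add_right blinfun.scaleR_right inner_simps a.add_left a.add_right
        a.scaleR_left a.scaleR_right algebra_simps)
    moreover have "bounded_linear (\<lambda>w. z \<bullet> \<iota> w)" by (intro bounded_linear_intros)
    moreover have "\<epsilon> * \<theta> * (norm v)\<^sup>2 \<le> c v v" for v
    proof -
      have "\<epsilon> * (\<theta> * (norm v)\<^sup>2) \<le> \<epsilon> * (- a v v + \<rho> * (norm (\<iota> v))\<^sup>2)"
        using garding[of v] \<epsilon> by (intro mult_left_mono) auto
      moreover have "\<epsilon> * \<rho> * (norm (\<iota> v))\<^sup>2 \<le> 1 * (norm (\<iota> v))\<^sup>2"
        using \<epsilon> \<rho> by (intro mult_right_mono) auto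
      ultimately show ?thesis by (simp add: c_def power2_norm_eq_inner[symmetric] algebra_simps)
    qed
    ultimately obtain v where v: "\<And>w. c v w = z \<bullet> \<iota> w"
      using lax_milgram[of c "\<lambda>w. z \<bullet> \<iota> w" "\<epsilon> * \<theta>"] \<epsilon> \<theta> by auto
    have "a v w = ((1 / \<epsilon>) *\<^sub>R (\<iota> v - z)) \<bullet> \<iota> w" for w
      using v[of w] \<epsilon> by (simp add: c_def inner_diff_left field_simps)
    then show ?thesis using \<epsilon> by (intro exI[of _ v] exI[of _ "(1 / \<epsilon>) *\<^sub>R (\<iota> v - z)"]) auto
  qed
  have "\<iota> w \<in> closure (fst ` generator \<iota> a)" for w
    unfolding closure_approachable
  proof (intro allI impI)
    fix e :: real assume e: "e > 0"
    obtain M where M: "M > 0" "\<And>v w. norm (a v w) \<le> norm v * norm w * M" using a.pos_bounded by blast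
    \<comment> \<open>The maximum of
      \<open>M * norm w * norm d - \<theta> * (norm d)\<^sup>2\<close> over \<open>norm d\<close>.
      As \<open>w\<close> need not lie in the domain, the Garding term has to absorb
      \<open>a w d\<close>.\<close>
    define k where "k = (M * norm w)\<^sup>2 / (4 * \<theta>)"
    have k: "k \<ge> 0" using \<theta> by (simp add: k_def)
    define \<epsilon> where "\<epsilon> = min (1 / (2 * \<rho> + 1)) (e\<^sup>2 / (4 * (k + 1)))"
    have \<epsilon>: "\<epsilon> > 0" using \<rho> e k by (simp add: \<epsilon>_def)
    have "\<epsilon> * (2 * \<rho> + 1) \<le> 1" using \<rho> by (simp add: \<epsilon>_def pos_le_divide_eq[symmetric])
    then have \<epsilon>\<rho>: "2 * \<epsilon> * \<rho> \<le> 1" using \<epsilon> by (simp add: algebra_simps)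
    obtain v h where v: "\<forall>w. a v w = h \<bullet> \<iota> w" "\<iota> v - \<epsilon> *\<^sub>R h = \<iota> w"
      using resolvent[OF \<epsilon> \<epsilon>\<rho>] by blast
    define d where "d = v - w"
    have "\<iota> d = \<epsilon> *\<^sub>R h" using v(2) by (simp add: d_def blinfun.diff_right algebra_simps)
    then have "\<iota> d \<bullet> \<iota> d = (\<epsilon> *\<^sub>R h) \<bullet> \<iota> d" by (rule arg_cong)
    then have "(norm (\<iota> d))\<^sup>2 = \<epsilon> * a v d"
      using v(1) by (simp add: power2_norm_eq_inner)
    also have "a v d = a d d + a w d" by (simp add: d_def a.diff_left)
    also have "\<dots> \<le> (\<rho> * (norm (\<iota> d))\<^sup>2 - \<theta> * (norm d)\<^sup>2) + M * norm w * norm d"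
      using garding[of d] M(2)[of w d] by (simp add: mult_ac)
    also have "\<dots> \<le> \<rho> * (norm (\<iota> d))\<^sup>2 + k"
    proof -
      have "0 \<le> \<theta> * (norm d - M * norm w / (2 * \<theta>))\<^sup>2" using \<theta> by simp
      also have "\<dots> = \<theta> * (norm d)\<^sup>2 - M * norm w * norm d + k"
        using \<theta> by (simp add: k_def power2_diff power_divide power_mult_distrib field_simps power2_eq_square)
      finally show ?thesis by simp
    qed
    finally have "(norm (\<iota> d))\<^sup>2 \<le> \<epsilon> * \<rho> * (norm (\<iota> d))\<^sup>2 + \<epsilon> * k"
      using \<epsilon> by (simp add: distrib_left mult.assoc)
    moreover have "\<epsilon> * \<rho> * (norm (\<iota> d))\<^sup>2 \<le> 1 / 2 * (norm (\<iota> d))\<^sup>2"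
      using \<epsilon>\<rho> by (intro mult_right_mono) auto
    ultimately have "(norm (\<iota> d))\<^sup>2 \<le> 2 * (\<epsilon> * k)" by linarith
    also have "\<dots> \<le> 2 * (e\<^sup>2 / (4 * (k + 1)) * (k + 1))"
      using k \<epsilon> by (intro mult_left_mono mult_mono) (auto simp: \<epsilon>_def)
    also have "\<dots> = e\<^sup>2 / 2" using k by (simp add: field_simps)
    also have "\<dots> < e\<^sup>2" using e by simp
    finally have "norm (\<iota> d) < e" using e by (simp add: power_less_imp_less_base)
    moreover have "\<iota> v \<in> fst ` generator \<iota> a" using v(1) by (force simp: generator_def)
    ultimately show "\<exists>y\<in>fst ` generator \<iota> a. dist y (\<iota> w) < e"
      by (intro bexI[of _ "\<iota> v"]) (auto simp: dist_norm d_def blinfun.diff_right)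
  qed
  then have "range \<iota> \<subseteq> closure (fst ` generator \<iota> a)" by auto
  then have "closure (range \<iota>) \<subseteq> closure (fst ` generator \<iota> a)"
    by (rule closure_minimal) simp
  then have "closure (fst ` generator \<iota> a) = UNIV" using dense by auto
  moreover have "\<exists>(x, y)\<in>generator \<iota> a. x - \<epsilon> *\<^sub>R y = z" if "\<epsilon> > 0" "2 * \<epsilon> * \<rho> \<le> 1" for \<epsilon> z
    using resolvent[OF that, of z] unfolding generator_def by blast
  ultimately show ?thesis
    unfolding m_dissipative_def using \<rho> sub diss by auto
qed

lemma bounded_bilinear_blinfun_apply2: "bounded_bilinear (\<lambda>v. blinfun_apply (blinfun_apply F v))"
  by (rule bounded_bilinear.comp[OF bounded_bilinear_blinfun_apply blinfun.bounded_linear_right bounded_linear_ident])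

text \<open>Density of the range of \<open>\<iota>\<close> makes the representative in H unique,
  which resolves the description operator in \<open>Arep\<close>.\<close>

lemma Arep_eqI:
  fixes \<iota> :: "'v::real_inner \<Rightarrow>\<^sub>L 'h::real_inner" and Op :: "'v \<Rightarrow>\<^sub>L 'v \<Rightarrow>\<^sub>L real"
  assumes "gelfand \<iota>" and "\<And>w. Op v w = h \<bullet> \<iota> w"
  shows "Arep \<iota> Op v = h"
  unfolding Arep_def
proof (rule the_equality)
  show "Hrep \<iota> (Op v) h" using assms(2) by (simp add: Hrep_def)
next
  fix h' assume "Hrep \<iota> (Op v) h'"
  then have *: "(h' - h) \<bullet> x = 0" if "x \<in> range \<iota>" for x
    using assms(2) that by (auto simp: Hrep_def inner_diff_left)
  have "(h' - h) \<bullet> x \<le> 0" for x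
    by (rule dense_le[where S = "range \<iota>"])
      (use assms(1) * in \<open>auto simp: gelfand_def intro!: continuous_intros\<close>)
  from this[of "h' - h"] have "h' - h = 0" by (metis antisym inner_eq_zero_iff inner_ge_zero)
  then show "h' = h" by simp
qed

lemma generator_Arep:
  fixes \<iota> :: "'v::real_inner \<Rightarrow>\<^sub>L 'h::real_inner" and Op :: "'v \<Rightarrow>\<^sub>L 'v \<Rightarrow>\<^sub>L real"
  assumes "gelfand \<iota>" and "(x, y) \<in> generator \<iota> (\<lambda>v. Op v)"
  obtains v where "x = \<iota> v" "v \<in> Dom \<iota> Op" "Arep \<iota> Op v = y"
proof -
  obtain v where v: "x = \<iota> v" "\<forall>w. Op v w = y \<bullet> \<iota> w" using assms(2) by (auto simp: generator_def)
  then show ?thesis using that[of v] Arep_eqI[OF assms(1)] by (auto simp: Dom_def Hrep_def)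
qed

section \<open>The adjoint of \<open>B\<close>, integrals over subintervals, and Riccati
  solutions\<close>

lemma inner_adjB: "adjB B x \<bullet> u = x \<bullet> B u"
proof -
  have "adjB B x \<bullet> u = (\<Sum>i\<in>Basis. (u \<bullet> i) * (B i \<bullet> x))"
    by (simp add: adjB_def inner_sum_left inner_commute[of u] mult.commute)
  also have "\<dots> = (\<Sum>i\<in>Basis. (u \<bullet> i) *\<^sub>R B i) \<bullet> x" by (simp add: inner_sum_left)
  also have "(\<Sum>i\<in>Basis. (u \<bullet> i) *\<^sub>R B i) = B (\<Sum>i\<in>Basis. (u \<bullet> i) *\<^sub>R i)"
    by (simp add: blinfun.sum_right blinfun.scaleR_right)
  finally show ?thesis unfolding euclidean_representation inner_commute[of x] .
qed

lemma norm_adjB_le: "norm (adjB B x) \<le> norm B * norm x"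
proof -
  have "norm (adjB B x) * norm (adjB B x) = x \<bullet> B (adjB B x)"
    by (simp add: inner_adjB[symmetric] dot_square_norm power2_eq_square)
  also have "\<dots> \<le> norm x * (norm B * norm (adjB B x))"
    by (meson norm_cauchy_schwarz norm_blinfun mult_left_mono norm_ge_zero order_trans)
  finally have "norm (adjB B x) * norm (adjB B x) \<le> norm (adjB B x) * (norm B * norm x)"
    by (simp add: mult_ac)
  then show ?thesis by (cases "adjB B x = 0") auto
qed

lemma adjB_diff: "adjB B (x - y) = adjB B x - adjB B y"
  by (simp add: adjB_def inner_diff_right scaleR_diff_left sum_subtractf)

lemma set_integral_increment:
  fixes F :: "real \<Rightarrow> real"
  assumes "0 \<le> s" "s \<le> t" and F: "set_integrable lborel {0..t} F"
  shows "set_integrable lborel {s..t} F"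
    and "(LINT r:{0..t}|lborel. F r) - (LINT r:{0..s}|lborel. F r) = (LINT r:{s..t}|lborel. F r)"
proof -
  show st: "set_integrable lborel {s..t} F"
    by (rule set_integrable_subset[OF F]) (use assms in auto)
  have st': "set_integrable lborel {s<..t} F"
    by (rule set_integrable_subset[OF F]) (use assms in auto)
  have os: "set_integrable lborel {0..s} F"
    by (rule set_integrable_subset[OF F]) (use assms in auto)
  have "{0..t} = {0..s} \<union> {s<..t}" "{0..s} \<inter> {s<..t} = {}" using assms by auto
  then have "(LINT r:{0..t}|lborel. F r) = (LINT r:{0..s}|lborel. F r) + (LINT r:{s<..t}|lborel. F r)"
    using set_integral_Un[OF _ os st'] by simp
  also have "(LINT r:{s<..t}|lborel. F r) = (LINT r:{s..t}|lborel. F r)"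
    by (rule set_integral_discrete_difference[where X = "{s}"]) auto
  finally show "(LINT r:{0..t}|lborel. F r) - (LINT r:{0..s}|lborel. F r) = (LINT r:{s..t}|lborel. F r)" by simp
qed

lemma set_integral_le_const:
  fixes F :: "real \<Rightarrow> real"
  assumes F: "set_integrable lborel {s..t} F" and "s \<le> t" and le: "\<And>r. r \<in> {s..t} \<Longrightarrow> F r \<le> c"
  shows "(LINT r:{s..t}|lborel. F r) \<le> (t - s) * c"
proof -
  have c: "set_integrable lborel {s..t} (\<lambda>r. c)"
    by (intro borel_integrable_atLeastAtMost' continuous_intros)
  have "(LINT r:{s..t}|lborel. F r) \<le> (LINT r:{s..t}|lborel. c)"
    by (rule set_integral_mono[OF F c]) (use le in auto)
  also have "\<dots> = (t - s) * c" using \<open>s \<le> t\<close> by (simp add: set_lebesgue_integral_def)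
  finally show ?thesis .
qed

text \<open>The constant sees A only through \<open>\<rho>\<close>, hence is the same for all
  parameters that share the Garding inequality.\<close>

lemma riccati_sol_norm_le:
  fixes \<iota> :: "'v::{real_inner,complete_space} \<Rightarrow>\<^sub>L 'h::{real_inner,complete_space}"
    and Op :: "'v \<Rightarrow>\<^sub>L 'v \<Rightarrow>\<^sub>L real"
  assumes gelfand: "gelfand \<iota>" and \<theta>: "\<theta> > 0" and \<rho>: "\<rho> \<ge> 0"
    and garding: "\<And>v. \<theta> * (norm v)\<^sup>2 \<le> - Op v v + \<rho> * (norm (\<iota> v))\<^sup>2"
    and sol: "riccati_sol T \<iota> Op B Q P Pm" and t: "t \<in> {0..T}"
  shows "norm (Pm t x) \<le> (exp (2 * \<rho> * T))\<^sup>2 * ((norm P)\<^sup>2 + T * (norm Q)\<^sup>2) * norm x"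
proof -
  let ?G = "generator \<iota> (\<lambda>v. Op v)"
  have G: "m_dissipative \<rho> ?G"
    using gelfand garding \<theta> \<rho>
    by (intro m_dissipative_generator bounded_bilinear_blinfun_apply2) (auto simp: gelfand_def)
  have sym: "Pm s x \<bullet> z = x \<bullet> Pm s z" if "s \<in> {0..T}" for s x z
    using sol that unfolding riccati_sol_def by blast
  have nonneg: "Pm s x \<bullet> x \<ge> 0" if "s \<in> {0..T}" for s x
    using sol that unfolding riccati_sol_def by blast
  have cont: "continuous_on {0..T} (\<lambda>t. Pm t x)" for x
    using sol unfolding riccati_sol_def by blast
  have init: "Pm 0 x \<bullet> z = P x \<bullet> P z" for x z
    using sol unfolding riccati_sol_def by blast
  have "\<exists>C. \<forall>s\<in>{0..T}. norm (Pm s x) \<le> C" for x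
    using compact_imp_bounded[OF compact_continuous_image[OF cont[of x] compact_Icc]]
    by (auto simp: bounded_iff)
  \<comment> \<open>This bound may depend on the solution and so on the parameter, which is harmless
    because \<open>riccati_bound\<close> does not pass it on.\<close>
  then obtain K where K: "K \<ge> 0" "\<And>s. s \<in> {0..T} \<Longrightarrow> norm (Pm s) \<le> K"
    using banach_steinhaus[of "{0..T}" Pm] by metis
  have KP: "norm (Pm s x) \<le> K * norm x" if "s \<in> {0..T}" for s x
    using K(2)[OF that] norm_blinfun[of "Pm s" x] by (meson mult_right_mono norm_ge_zero order_trans)
  \<comment> \<open>\<open>x'\<close> and \<open>z'\<close> stand for A x and A z, which makes
    \<open>F\<close> the right-hand side of the tested Riccati equation.\<close>
  define F where "F x x' z z' s = Pm s x \<bullet> z' + x' \<bullet> Pm s z - adjB B (Pm s x) \<bullet> adjB B (Pm s z) + Q x \<bullet> Q z"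
    for x x' z z' s
  have increment: "set_integrable lborel {s..t} (F x x' z z')"
      "Pm t x \<bullet> z - Pm s x \<bullet> z = (LINT r:{s..t}|lborel. F x x' z z' r)"
    if mem: "(x, x') \<in> ?G" "(z, z') \<in> ?G" and st: "0 \<le> s" "s \<le> t" "t \<le> T" for x x' z z' s t
  proof -
    obtain v w where v: "x = \<iota> v" "v \<in> Dom \<iota> Op" "Arep \<iota> Op v = x'"
      and w: "z = \<iota> w" "w \<in> Dom \<iota> Op" "Arep \<iota> Op w = z'"
      using generator_Arep[OF gelfand mem(1)] generator_Arep[OF gelfand mem(2)] by metis
    have *: "set_integrable lborel {0..r} (F x x' z z')"
      "Pm r x \<bullet> z = P x \<bullet> P z + (LINT u:{0..r}|lborel. F x x' z z' u)" if "r \<in> {0..T}" for r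
      using sol that v w unfolding riccati_sol_def F_def Let_def by auto
    have int: "set_integrable lborel {0..t} (F x x' z z')" using * st by auto
    show "set_integrable lborel {s..t} (F x x' z z')"
      by (rule set_integral_increment[OF st(1,2) int])
    show "Pm t x \<bullet> z - Pm s x \<bullet> z = (LINT r:{s..t}|lborel. F x x' z z' r)"
      using *(2)[of t] *(2)[of s] set_integral_increment(2)[OF st(1,2) int] st by simp
  qed
  define L where "L = 2 * K + (norm B * K)\<^sup>2 + (norm Q)\<^sup>2"
  have L: "L \<ge> 0" using K by (simp add: L_def)
  have F_bound: "\<bar>F x x' z z' s\<bar> \<le> L * (norm x + norm x') * (norm z + norm z')" if s: "s \<in> {0..T}" for x x' z z' s
  proof -
    let ?X = "norm x + norm x'" and ?Z = "norm z + norm z'"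
    have "\<bar>Pm s x \<bullet> z'\<bar> \<le> (K * ?X) * ?Z"
      using Cauchy_Schwarz_ineq2[of "Pm s x" z'] KP[OF s, of x] K(1)
      by (elim order_trans, intro mult_mono order_trans[OF KP[OF s]] mult_left_mono) auto
    moreover have "\<bar>x' \<bullet> Pm s z\<bar> \<le> ?X * (K * ?Z)"
      using Cauchy_Schwarz_ineq2[of x' "Pm s z"] K(1)
      by (elim order_trans, intro mult_mono order_trans[OF KP[OF s]] mult_left_mono) auto
    moreover have "\<bar>adjB B (Pm s x) \<bullet> adjB B (Pm s z)\<bar> \<le> (norm B * (K * ?X)) * (norm B * (K * ?Z))"
      using Cauchy_Schwarz_ineq2[of "adjB B (Pm s x)" "adjB B (Pm s z)"] K(1)
      by (elim order_trans, intro mult_mono order_trans[OF norm_adjB_le] order_trans[OF KP[OF s]] mult_left_mono) auto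
    moreover have "\<bar>Q x \<bullet> Q z\<bar> \<le> (norm Q * ?X) * (norm Q * ?Z)"
      using Cauchy_Schwarz_ineq2[of "Q x" "Q z"]
      by (elim order_trans, intro mult_mono order_trans[OF norm_blinfun] mult_left_mono) auto
    ultimately have "\<bar>F x x' z z' s\<bar> \<le> (K * ?X) * ?Z + ?X * (K * ?Z)
        + (norm B * (K * ?X)) * (norm B * (K * ?Z)) + (norm Q * ?X) * (norm Q * ?Z)"
      unfolding F_def by linarith
    also have "\<dots> = L * ?X * ?Z" unfolding L_def power2_eq_square by algebra
    finally show ?thesis .
  qed
  have "Pm t x \<bullet> x \<le> (exp (2 * \<rho> * T))\<^sup>2 * ((norm P)\<^sup>2 + T * (norm Q)\<^sup>2) * (norm x)\<^sup>2" for x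
  proof (rule riccati_bound[OF G _ _ K(1) L K(2) sym _ _ _ t])
    show "Pm 0 x \<bullet> x \<le> (norm P)\<^sup>2 * (norm x)\<^sup>2" for x
      using power_mono[OF norm_blinfun[of P x], of 2]
      by (simp add: init power2_norm_eq_inner[symmetric] power_mult_distrib)
  next
    fix x x' z z' s t assume *: "(x, x') \<in> ?G" "(z, z') \<in> ?G" "0 \<le> s" "s \<le> t" "t \<le> T"
    let ?c = "L * (norm x + norm x') * (norm z + norm z')"
    have int: "set_integrable lborel {s..t} (F x x' z z')" by (rule increment(1)[OF *])
    have "F x x' z z' r \<le> ?c" "- F x x' z z' r \<le> ?c" if "r \<in> {s..t}" for r
      using F_bound[of r x x' z z'] that * by auto
    then have "(LINT r:{s..t}|lborel. F x x' z z' r) \<le> (t - s) * ?c"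
      "(LINT r:{s..t}|lborel. - F x x' z z' r) \<le> (t - s) * ?c"
      using int * by (auto intro!: set_integral_le_const simp: set_integrable_def)
    then show "\<bar>Pm t x \<bullet> z - Pm s x \<bullet> z\<bar> \<le> ?c * (t - s)"
      unfolding increment(2)[OF *] by (simp add: set_lebesgue_integral_def abs_le_iff mult.commute)
  next
    fix x x' s t c assume *: "(x, x') \<in> ?G" "0 \<le> s" "s \<le> t" "t \<le> T"
      and c: "\<And>r. r \<in> {s..t} \<Longrightarrow> 2 * (Pm r x \<bullet> x') \<le> c"
    \<comment> \<open>The term containing \<open>adjB B (Pm r x)\<close> is minus a square and is
      dropped; this is the sign that keeps \<open>B\<close> out of the bound.\<close>
    have "F x x' x x' r \<le> c + (norm Q)\<^sup>2 * (norm x)\<^sup>2" if r: "r \<in> {s..t}" for r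
    proof -
      have "Q x \<bullet> Q x \<le> (norm Q)\<^sup>2 * (norm x)\<^sup>2"
        using power_mono[OF norm_blinfun[of Q x], of 2]
        by (simp add: power2_norm_eq_inner[symmetric] power_mult_distrib)
      then show ?thesis
        using c[OF r] inner_ge_zero[of "adjB B (Pm r x)"] unfolding F_def inner_commute[of x'] by linarith
    qed
    then show "Pm t x \<bullet> x - Pm s x \<bullet> x \<le> (t - s) * (c + (norm Q)\<^sup>2 * (norm x)\<^sup>2)"
      unfolding increment(2)[OF *(1) *(1-4)]
      by (intro set_integral_le_const increment(1) *) auto
  qed auto
  then show ?thesis
    using t by (intro norm_le_of_quadratic_form sym nonneg) auto
qed

section \<open>Weak evolution equations\<close>

text \<open>The feedback evaluated along its own trajectory counts as a given forcing
  \<open>g\<close>. This makes the notion linear in \<open>g\<close>, \<open>yH\<close> and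
  \<open>yV\<close>, so that states with different feedbacks can be subtracted.\<close>

definition weak_evolution ::
  "real \<Rightarrow> ('v::real_inner \<Rightarrow>\<^sub>L 'h::real_inner) \<Rightarrow> ('v \<Rightarrow>\<^sub>L 'v \<Rightarrow>\<^sub>L real) \<Rightarrow> (real \<Rightarrow> 'h) \<Rightarrow> (real \<Rightarrow> 'h) \<Rightarrow> (real \<Rightarrow> 'v) \<Rightarrow> bool" where
  "weak_evolution T \<iota> Op g yH yV \<longleftrightarrow>
     continuous_on {0..T} yH \<and> (AE t in lborel. t \<in> {0..T} \<longrightarrow> \<iota> (yV t) = yH t) \<and>
     (\<forall>w. \<forall>t\<in>{0..T}.
        set_integrable lborel {0..t} (\<lambda>s. Op (yV s) w + g s \<bullet> \<iota> w) \<and>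
        yH t \<bullet> \<iota> w = yH 0 \<bullet> \<iota> w + (LINT s:{0..t}|lborel. Op (yV s) w + g s \<bullet> \<iota> w))"

lemma closed_loop_sol_weak_evolution:
  "closed_loop_sol T \<iota> Op B F f y0 yH yV \<Longrightarrow> weak_evolution T \<iota> Op (\<lambda>s. B (F s (yH s)) + f s) yH yV"
  unfolding closed_loop_sol_def weak_evolution_def by auto

lemma closed_loop_sol_init: "closed_loop_sol T \<iota> Op B F f y0 yH yV \<Longrightarrow> yH 0 = y0"
  by (simp add: closed_loop_sol_def)

lemma weak_evolution_diff:
  assumes "weak_evolution T \<iota> Op g yH yV" "weak_evolution T \<iota> Op g' zH zV"
  shows "weak_evolution T \<iota> Op (\<lambda>s. g s - g' s) (\<lambda>s. yH s - zH s) (\<lambda>s. yV s - zV s)"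
  unfolding weak_evolution_def
proof (intro conjI allI ballI)
  show "continuous_on {0..T} (\<lambda>s. yH s - zH s)"
    using assms unfolding weak_evolution_def by (intro continuous_on_diff) auto
  have "AE t in lborel. t \<in> {0..T} \<longrightarrow> \<iota> (yV t) = yH t" "AE t in lborel. t \<in> {0..T} \<longrightarrow> \<iota> (zV t) = zH t"
    using assms unfolding weak_evolution_def by auto
  then show "AE t in lborel. t \<in> {0..T} \<longrightarrow> \<iota> (yV t - zV t) = yH t - zH t"
    by eventually_elim (simp add: blinfun.diff_right)
next
  fix w t assume t: "t \<in> {0..T}"
  let ?F = "\<lambda>s. Op (yV s) w + g s \<bullet> \<iota> w" and ?F' = "\<lambda>s. Op (zV s) w + g' s \<bullet> \<iota> w"
  have y: "set_integrable lborel {0..t} ?F" "yH t \<bullet> \<iota> w = yH 0 \<bullet> \<iota> w + (LINT s:{0..t}|lborel. ?F s)"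
    and z: "set_integrable lborel {0..t} ?F'" "zH t \<bullet> \<iota> w = zH 0 \<bullet> \<iota> w + (LINT s:{0..t}|lborel. ?F' s)"
    using assms t unfolding weak_evolution_def by blast+
  have eq: "(\<lambda>s. Op (yV s - zV s) w + (g s - g' s) \<bullet> \<iota> w) = (\<lambda>s. ?F s - ?F' s)"
    by (auto simp: blinfun.diff_right blinfun.diff_left inner_diff_left)
  show "set_integrable lborel {0..t} (\<lambda>s. Op (yV s - zV s) w + (g s - g' s) \<bullet> \<iota> w)"
    unfolding eq using y z by (intro set_integral_diff)
  show "(yH t - zH t) \<bullet> \<iota> w = (yH 0 - zH 0) \<bullet> \<iota> w
      + (LINT s:{0..t}|lborel. Op (yV s - zV s) w + (g s - g' s) \<bullet> \<iota> w)"
    unfolding eq using set_integral_diff(2)[OF y(1) z(1)] y(2) z(2) unfolding inner_diff_left by linarith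
qed

text \<open>For \<open>v\<close> in the domain of the adjoint, \<open>Op (yV r) v\<close> equals
  \<open>yH r \<bullet> w'\<close> for almost every \<open>r\<close>; the V-valued version
  disappears and \<open>evolution_bound\<close> applies to the continuous \<open>yH\<close>. The
  majorant \<open>\<gamma>\<close> stands in for \<open>norm (g s)\<close>, whose measurability is
  not assumed.\<close>

lemma weak_evolution_norm_le:
  fixes \<iota> :: "'v::{real_inner,complete_space} \<Rightarrow>\<^sub>L 'h::{real_inner,complete_space}"
    and Op :: "'v \<Rightarrow>\<^sub>L 'v \<Rightarrow>\<^sub>L real" and \<gamma> :: "real \<Rightarrow> real"
  assumes gelfand: "gelfand \<iota>" and \<theta>: "\<theta> > 0" and \<rho>: "\<rho> \<ge> 0"
    and garding: "\<And>v. \<theta> * (norm v)\<^sup>2 \<le> - Op v v + \<rho> * (norm (\<iota> v))\<^sup>2"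
    and sol: "weak_evolution T \<iota> Op g yH yV"
    and \<gamma>: "set_integrable lborel {0..T} \<gamma>" and g_le: "\<And>s. s \<in> {0..T} \<Longrightarrow> norm (g s) \<le> \<gamma> s"
    and t: "t \<in> {0..T}"
  shows "norm (yH t) \<le> exp (2 * \<rho> * T) * (norm (yH 0) + (LINT s:{0..t}|lborel. \<gamma> s))"
proof -
  let ?G = "generator \<iota> (\<lambda>v w. Op w v)"
  have G: "m_dissipative \<rho> ?G"
    using gelfand garding \<theta> \<rho>
    by (intro m_dissipative_generator bounded_bilinear.flip[OF bounded_bilinear_blinfun_apply2])
      (auto simp: gelfand_def)
  define \<Gamma> where "\<Gamma> t = (LINT s:{0..t}|lborel. \<gamma> s)" for t
  have \<gamma>_int: "set_integrable lborel {0..t} \<gamma>" if "t \<le> T" for t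
    by (rule set_integrable_subset[OF \<gamma>]) (use that in auto)
  have \<Gamma>_diff: "\<Gamma> t - \<Gamma> s = (LINT r:{s..t}|lborel. \<gamma> r)" "set_integrable lborel {s..t} \<gamma>"
    if "0 \<le> s" "s \<le> t" "t \<le> T" for s t
    using set_integral_increment[OF that(1,2) \<gamma>_int[OF that(3)]] by (auto simp: \<Gamma>_def)
  have "norm (yH t) \<le> exp (2 * \<rho> * T) * (norm (yH 0) + (\<Gamma> t - \<Gamma> 0))"
  proof (rule evolution_bound[OF G _ _ _ t])
    show "continuous_on {0..T} yH" using sol by (simp add: weak_evolution_def)
  next
    fix s t assume st: "0 \<le> s" "s \<le> t" "t \<le> T"
    have "0 \<le> \<gamma> r" if "r \<in> {s..t}" for r
      using order_trans[OF norm_ge_zero g_le[of r]] that st by auto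
    then have "0 \<le> (LINT r:{s..t}|lborel. \<gamma> r)"
      unfolding set_lebesgue_integral_def by (intro integral_nonneg_AE) (auto simp: indicator_def)
    then show "\<Gamma> s \<le> \<Gamma> t" using \<Gamma>_diff(1)[OF st] by simp
  next
    fix w w' s t c assume ww': "(w, w') \<in> ?G" and st: "0 \<le> s" "s \<le> t" "t \<le> T"
      and c: "\<And>r. r \<in> {s..t} \<Longrightarrow> yH r \<bullet> w' \<le> c"
    obtain v where v: "w = \<iota> v" "\<And>u. Op u v = w' \<bullet> \<iota> u" using ww' by (auto simp: generator_def)
    let ?F = "\<lambda>s. Op (yV s) v + g s \<bullet> \<iota> v"
    have F: "set_integrable lborel {0..r} ?F" "yH r \<bullet> w = yH 0 \<bullet> w + (LINT s:{0..r}|lborel. ?F s)"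
      if "r \<in> {0..T}" for r
      using sol that unfolding weak_evolution_def v(1) by blast+
    have Ft: "set_integrable lborel {0..t} ?F" using F(1)[of t] st by simp
    note incr = set_integral_increment[OF st(1,2) Ft]
    have const: "set_integrable lborel {s..t} (\<lambda>r. c)"
      by (intro borel_integrable_atLeastAtMost' continuous_intros)
    have w\<gamma>: "set_integrable lborel {s..t} (\<lambda>r. norm w * \<gamma> r)"
      using \<Gamma>_diff(2)[OF st] by simp
    have sum_int: "set_integrable lborel {s..t} (\<lambda>r. c + norm w * \<gamma> r)"
      using const w\<gamma> by (rule set_integral_add)
    have "(yH t - yH s) \<bullet> w = (LINT r:{s..t}|lborel. ?F r)"
      using F(2)[of t] F(2)[of s] incr(2) st unfolding inner_diff_left atLeastAtMost_iff by linarith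
    also have "\<dots> \<le> (LINT r:{s..t}|lborel. c + norm w * \<gamma> r)"
    proof (rule set_integral_mono_AE[OF incr(1) sum_int])
      have "AE r in lborel. r \<in> {0..T} \<longrightarrow> \<iota> (yV r) = yH r"
        using sol unfolding weak_evolution_def by blast
      then show "AE r\<in>{s..t} in lborel. ?F r \<le> c + norm w * \<gamma> r"
      proof eventually_elim
        case (elim r)
        show ?case
        proof
          assume r: "r \<in> {s..t}"
          have "Op (yV r) v = yH r \<bullet> w'" using elim r st v(2) by (auto simp: inner_commute)
          moreover have "g r \<bullet> \<iota> v \<le> norm (g r) * norm w" unfolding v(1) by (rule norm_cauchy_schwarz)
          moreover have "norm (g r) * norm w \<le> \<gamma> r * norm w"
            using r st by (intro mult_right_mono g_le) auto
          ultimately show "?F r \<le> c + norm w * \<gamma> r" using c[OF r] by (simp add: mult.commute)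
        qed
      qed
    qed
    also have "\<dots> = (t - s) * c + norm w * (\<Gamma> t - \<Gamma> s)"
      using set_integral_add(2)[OF const w\<gamma>] st \<Gamma>_diff(1)[OF st]
      by (simp add: set_lebesgue_integral_def)
    finally show "(yH t - yH s) \<bullet> w \<le> (t - s) * c + norm w * (\<Gamma> t - \<Gamma> s)" .
  qed
  moreover have "\<Gamma> 0 = (LINT s:{}|lborel. \<gamma> s)"
    unfolding \<Gamma>_def by (rule set_integral_discrete_difference[where X = "{0}"]) auto
  ultimately show ?thesis by (simp add: \<Gamma>_def set_lebesgue_integral_def)
qed

text \<open>The rate contains \<open>c + 1\<close> instead of \<open>c\<close> because
  \<open>gronwall_bound\<close> asks for a positive rate and \<open>c\<close> may be 0.\<close>

lemma weak_evolution_gronwall: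
  fixes \<iota> :: "'v::{real_inner,complete_space} \<Rightarrow>\<^sub>L 'h::{real_inner,complete_space}"
    and Op :: "'v \<Rightarrow>\<^sub>L 'v \<Rightarrow>\<^sub>L real" and k :: "real \<Rightarrow> real"
  assumes gelfand: "gelfand \<iota>" and \<theta>: "\<theta> > 0" and \<rho>: "\<rho> \<ge> 0"
    and garding: "\<And>v. \<theta> * (norm v)\<^sup>2 \<le> - Op v v + \<rho> * (norm (\<iota> v))\<^sup>2"
    and sol: "weak_evolution T \<iota> Op g yH yV"
    and k: "set_integrable lborel {0..T} k" "\<And>s. s \<in> {0..T} \<Longrightarrow> 0 \<le> k s" and c: "c \<ge> 0"
    and g_le: "\<And>s. s \<in> {0..T} \<Longrightarrow> norm (g s) \<le> k s + c * norm (yH s)"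
    and t: "t \<in> {0..T}"
  shows "norm (yH t) \<le> 2 * (exp (2 * \<rho> * T) * (norm (yH 0) + (LINT s:{0..T}|lborel. k s)))
    * exp (2 * (exp (2 * \<rho> * T) * (c + 1)) * T)"
proof -
  define D where "D = exp (2 * \<rho> * T)"
  have T: "0 \<le> T" using t by auto
  have D: "D > 0" by (simp add: D_def)
  have yH: "continuous_on {0..T} yH" using sol by (simp add: weak_evolution_def)
  then have u: "continuous_on {0..T} (\<lambda>s. norm (yH s))" by (intro continuous_intros)
  have k_nonneg: "0 \<le> (LINT s:{0..T}|lborel. k s)"
    unfolding set_lebesgue_integral_def using k(2)
    by (intro integral_nonneg_AE) (auto simp: indicator_def)
  have "norm (yH t) \<le> 2 * (D * (norm (yH 0) + (LINT s:{0..T}|lborel. k s))) * exp (2 * (D * (c + 1)) * T)"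
  proof (rule gronwall_bound[OF T u _ _ t])
    fix t assume t: "t \<in> {0..T}"
    have ut: "set_integrable lborel {0..t} (\<lambda>s. norm (yH s))"
      using t by (intro borel_integrable_atLeastAtMost' continuous_on_subset[OF u]) auto
    then have cu: "set_integrable lborel {0..t} (\<lambda>s. (c + 1) * norm (yH s))" by simp
    have kt: "set_integrable lborel {0..t} k"
      by (rule set_integrable_subset[OF k(1)]) (use t in auto)
    have "set_integrable lborel {0..T} (\<lambda>s. norm (yH s))"
      by (rule borel_integrable_atLeastAtMost'[OF u])
    then have "set_integrable lborel {0..T} (\<lambda>s. k s + (c + 1) * norm (yH s))"
      using k(1) by (intro set_integral_add) auto
    moreover have "norm (g s) \<le> k s + (c + 1) * norm (yH s)" if "s \<in> {0..T}" for s
      using g_le[OF that] using norm_ge_zero[of "yH s"] unfolding distrib_right by linarith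
    ultimately have "norm (yH t) \<le> D * (norm (yH 0) + (LINT s:{0..t}|lborel. k s + (c + 1) * norm (yH s)))"
      unfolding D_def by (intro weak_evolution_norm_le[OF gelfand \<theta> \<rho> garding sol _ _ t])
    also have "(LINT s:{0..t}|lborel. k s + (c + 1) * norm (yH s))
        = (LINT s:{0..t}|lborel. k s) + (c + 1) * integral {0..t} (\<lambda>s. norm (yH s))"
      using set_integral_add(2)[OF kt cu] set_borel_integral_eq_integral(2)[OF ut] by simp
    also have "(LINT s:{0..t}|lborel. k s) \<le> (LINT s:{0..T}|lborel. k s)"
    proof -
      have "indicator {0..t} s *\<^sub>R k s \<le> indicator {0..T} s *\<^sub>R k s" for s
        using k(2)[of s] t by (auto simp: indicator_def)
      then show ?thesis
        using kt k(1) unfolding set_lebesgue_integral_def set_integrable_def by (intro integral_mono) auto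
    qed
    finally show "norm (yH t) \<le> D * (norm (yH 0) + (LINT s:{0..T}|lborel. k s))
        + D * (c + 1) * integral {0..t} (\<lambda>s. norm (yH s))"
      using D by (simp add: algebra_simps)
  qed (use D c k_nonneg in auto)
  then show ?thesis by (simp add: D_def)
qed

section \<open>Mean and cubature feedback\<close>

lemma prob_space_Smeas: "prob_space Smeas"
  unfolding Smeas_def
proof (rule prob_space_PiM)
  show "prob_space (restrict_space lborel {-1/2..1/2::real})"
    by (intro prob_spaceI) (simp add: emeasure_restrict_space space_restrict_space)
qed

lemma space_Smeas: "space Smeas = Sfrak"
  by (auto simp: Smeas_def Sfrak_def space_PiM space_restrict_space PiE_def)

text \<open>No measurability is needed: a non-integrable integrand has integral 0.\<close>

lemma meanBPi_norm_le:
  fixes Pm :: "(nat \<Rightarrow> real) \<Rightarrow> real \<Rightarrow> 'h::real_inner \<Rightarrow>\<^sub>L 'h"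
  assumes "\<And>\<sigma>. \<sigma> \<in> Sfrak \<Longrightarrow> norm (Bs (Pm \<sigma> \<tau> x)) \<le> C" and "C \<ge> 0"
  shows "norm (meanBPi Bs Pm \<tau> x) \<le> C"
proof -
  interpret prob_space Smeas by (rule prob_space_Smeas)
  show ?thesis
  proof (cases "integrable Smeas (\<lambda>\<sigma>. Bs (Pm \<sigma> \<tau> x))")
    case True
    have "norm (meanBPi Bs Pm \<tau> x) \<le> expectation (\<lambda>\<sigma>. norm (Bs (Pm \<sigma> \<tau> x)))"
      unfolding meanBPi_def by (rule integral_norm_bound)
    also have "\<dots> \<le> expectation (\<lambda>\<sigma>. C)"
      using True assms(1) by (intro integral_mono) (auto simp: space_Smeas)
    finally show ?thesis by (simp add: prob_space)
  qed (use assms(2) in \<open>simp add: meanBPi_def not_integrable_integral_eq\<close>)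
qed

text \<open>The map f need not be linear; the hypothesis keeps the supremum defining onorm from being a junk value.\<close>

lemma norm_le_onorm:
  assumes "\<And>x. norm (f x) \<le> C * norm x"
  shows "norm (f x) \<le> onorm f * norm x" "0 \<le> onorm f"
proof -
  have "norm (f x) / norm x \<le> max C 0" for x
    using assms[of x] by (cases "x = 0") (auto simp: divide_le_eq le_max_iff_disj)
  then have "bdd_above (range (\<lambda>x. norm (f x) / norm x))" by (intro bdd_aboveI[of _ "max C 0"]) auto
  then have ge: "norm (f x) / norm x \<le> onorm f" for x unfolding onorm_def by (intro cSUP_upper) auto
  show "norm (f x) \<le> onorm f * norm x"
    using ge[of x] assms[of x] by (cases "x = 0") (auto simp: divide_le_eq)
  show "0 \<le> onorm f" using ge[of 0] by simp
qed

lemma trunc_in_Sfrak: "(\<And>i. i < s \<Longrightarrow> \<sigma> i \<in> {-1/2..1/2}) \<Longrightarrow> trunc s \<sigma> \<in> Sfrak"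
  by (auto simp: trunc_def Sfrak_def)

lemma cubBPi_diff:
  "cubBPi (adjB B) Pm s N \<alpha> nd \<tau> (x - y) = cubBPi (adjB B) Pm s N \<alpha> nd \<tau> x - cubBPi (adjB B) Pm s N \<alpha> nd \<tau> y"
  by (simp add: cubBPi_def blinfun.diff_right adjB_diff scaleR_diff_right sum_subtractf)

lemma cubBPi_norm_le:
  fixes Pm :: "(nat \<Rightarrow> real) \<Rightarrow> real \<Rightarrow> 'h::real_inner \<Rightarrow>\<^sub>L 'h"
  assumes "\<And>k. k < N \<Longrightarrow> norm (Bs (Pm (trunc s (nd k)) \<tau> x)) \<le> C"
  shows "norm (cubBPi Bs Pm s N \<alpha> nd \<tau> x) \<le> (\<Sum>k<N. \<bar>\<alpha> k\<bar>) * C"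
  unfolding cubBPi_def sum_distrib_right
  by (rule order_trans[OF norm_sum]) (use assms in \<open>auto intro!: sum_mono mult_left_mono\<close>)

text \<open>The maximum over time enters through its upper bounds \<open>M\<close>; where it is
  attained, it is the smallest of them. \<open>Cy\<close> and \<open>Cu\<close> are chosen before
  \<open>\<sigma>\<close>, \<open>t\<close> and \<open>M\<close>.\<close>

theorem theorem6p1:
  fixes T :: real
    and \<iota> :: "'v::{real_inner,complete_space,second_countable_topology} \<Rightarrow>\<^sub>L
             'h::{real_inner,complete_space,second_countable_topology}"
    and B :: "'u::euclidean_space \<Rightarrow>\<^sub>L 'h"
    and Q P :: "'h \<Rightarrow>\<^sub>L 'h"
    and A :: "(nat \<Rightarrow> real) \<Rightarrow> ('v \<Rightarrow>\<^sub>L 'v \<Rightarrow>\<^sub>L real)"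
    and \<rho> \<theta> CA CAt p :: real
    and b :: "nat \<Rightarrow> real"
    and DR :: "(nat \<Rightarrow> nat) \<Rightarrow> (nat \<Rightarrow> real) \<Rightarrow> ('v \<Rightarrow>\<^sub>L 'v \<Rightarrow>\<^sub>L real)"
    and E :: "(nat \<Rightarrow> nat) \<Rightarrow> (nat \<Rightarrow> real) \<Rightarrow> 'v \<Rightarrow> 'h"
    and f :: "real \<Rightarrow> 'h"
    and gH gd :: "real \<Rightarrow> 'h" and gV :: "real \<Rightarrow> 'v"
    and y0 :: 'h
    and Pm :: "(nat \<Rightarrow> real) \<Rightarrow> real \<Rightarrow> ('h \<Rightarrow>\<^sub>L 'h)"
    and hH :: "(nat \<Rightarrow> real) \<Rightarrow> real \<Rightarrow> 'h" and hV :: "(nat \<Rightarrow> real) \<Rightarrow> real \<Rightarrow> 'v"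
    and s N :: nat and \<alpha> :: "nat \<Rightarrow> real" and nd :: "nat \<Rightarrow> nat \<Rightarrow> real"
    and yH yhH :: "(nat \<Rightarrow> real) \<Rightarrow> real \<Rightarrow> 'h" and yV yhV :: "(nat \<Rightarrow> real) \<Rightarrow> real \<Rightarrow> 'v"
  assumes T_pos: "T > 0"
    and gelfand: "gelfand \<iota>"
    \<comment> \<open>(A2) G\<aa>rding inequality, with a(sigma;v,w) = - <A_sigma v, w>\<close>
    and A2: "\<theta> > 0" "\<forall>\<sigma>\<in>Sfrak. \<forall>v. - blinfun_apply (blinfun_apply (A \<sigma>) v) v + \<rho> * (norm (blinfun_apply \<iota> v))\<^sup>2
                                   \<ge> \<theta> * (norm v)\<^sup>2"
    \<comment> \<open>(A3)\<close>
    and A3: "\<forall>\<sigma>\<in>Sfrak. norm (A \<sigma>) \<le> CA"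
    \<comment> \<open>(R)\<close>
    and R_b: "\<forall>j. b j \<ge> 0" "0 < p" "p \<le> 1" "summable (\<lambda>j. b j powr p)"
    and R_D: "has_partials A DR"
    and R_bound: "\<forall>\<nu> \<sigma>. fin_supp \<nu> \<longrightarrow> \<nu> \<noteq> (\<lambda>_. 0) \<longrightarrow> \<sigma> \<in> Sfrak \<longrightarrow> norm (DR \<nu> \<sigma>) \<le> bpow b \<nu>"
    \<comment> \<open>(A4)\<close>
    and A4: "\<forall>\<sigma>\<in>Sfrak. Dom \<iota> (A \<sigma>) = Dom \<iota> (A (\<lambda>_. 0)) \<and> DomAdj \<iota> (A \<sigma>) = Dom \<iota> (A (\<lambda>_. 0))"
    \<comment> \<open>(A5)\<close>
    and A5_D: "has_partials_DA \<iota> A E"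
    and A5_bound: "\<forall>\<nu> \<sigma>. fin_supp \<nu> \<longrightarrow> \<nu> \<noteq> (\<lambda>_. 0) \<longrightarrow> \<sigma> \<in> Sfrak \<longrightarrow>
                    (\<forall>v\<in>Dom \<iota> (A (\<lambda>_. 0)). norm (E \<nu> \<sigma> v) \<le> bpow b \<nu> * normDA \<iota> A v)"
    \<comment> \<open>(A6)\<close>
    and A6: "\<forall>\<sigma>\<in>Sfrak. \<forall>v\<in>Dom \<iota> (A (\<lambda>_. 0)). norm (Arep \<iota> (A \<sigma>) v) \<le> CAt * normDA \<iota> A v"
    \<comment> \<open>data: f in L2(0,T;H)\<close>
    and f_L2: "L2 T f"
    \<comment> \<open>data: g in W^{1,2}(0,T;H) \<inter> L2(0,T;D(A)), derivative gd\<close>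
    and g_W12: "L2 T gH" "L2 T gd"
               "\<forall>t\<in>{0..T}. set_integrable lborel {0..t} gd \<and> gH t = gH 0 + set_lebesgue_integral lborel {0..t} gd"
    and g_DA: "AE t in lborel. t \<in> {0..T} \<longrightarrow> gV t \<in> Dom \<iota> (A (\<lambda>_. 0)) \<and> blinfun_apply \<iota> (gV t) = gH t"
              "L2 T gV" "L2 T (\<lambda>t. Arep \<iota> (A (\<lambda>_. 0)) (gV t))"
    \<comment> \<open>Riccati solutions and adjoint states, r_sigma = f + A_sigma g - g'\<close>
    and Pi_sol: "\<forall>\<sigma>\<in>Sfrak. riccati_sol T \<iota> (A \<sigma>) B Q P (Pm \<sigma>)"
    and h_sol: "\<forall>\<sigma>\<in>Sfrak. adj_sol T \<iota> (A \<sigma>) B (Pm \<sigma>)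
                   (\<lambda>t. f t + Arep \<iota> (A \<sigma>) (gV t) - gd t) (hH \<sigma>) (hV \<sigma>)"
    \<comment> \<open>cubature nodes in [-1/2,1/2]^s, weights arbitrary reals\<close>
    and nodes: "\<forall>k<N. \<forall>i<s. nd k i \<in> {-1/2..1/2}"
    \<comment> \<open>closed-loop states with the mean feedback K and the approximate feedback K-hat\<close>
    and y_sol: "\<forall>\<sigma>\<in>Sfrak. closed_loop_sol T \<iota> (A \<sigma>) B
                  (\<lambda>t x. - meanBPi (adjB B) Pm (T - t) x - meanBh (adjB B) hH t) f y0 (yH \<sigma>) (yV \<sigma>)"
    and yh_sol: "\<forall>\<sigma>\<in>Sfrak. closed_loop_sol T \<iota> (A \<sigma>) B
                  (\<lambda>t x. - cubBPi (adjB B) Pm s N \<alpha> nd (T - t) x - cubBh (adjB B) hH s N \<alpha> nd t) f y0 (yhH \<sigma>) (yhV \<sigma>)"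
  shows "\<exists>Cy>0. \<exists>Cu>0. \<forall>\<sigma>\<in>Sfrak. \<forall>t\<in>{0..T}. \<forall>M.
           (\<forall>\<tau>\<in>{0..T}. onorm (\<lambda>x. meanBPi (adjB B) Pm (T - \<tau>) x - cubBPi (adjB B) Pm s N \<alpha> nd (T - \<tau>) x)
                        + norm (meanBh (adjB B) hH \<tau> - cubBh (adjB B) hH s N \<alpha> nd \<tau>) \<le> M) \<longrightarrow>
           norm (yH \<sigma> t - yhH \<sigma> t) \<le> Cy * M \<and>
           norm ((- meanBPi (adjB B) Pm (T - t) (yH \<sigma> t) - meanBh (adjB B) hH t)
               - (- cubBPi (adjB B) Pm s N \<alpha> nd (T - t) (yhH \<sigma> t) - cubBh (adjB B) hH s N \<alpha> nd t)) \<le> Cu * M"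
\<comment> \<open>If no bound exists, the premise on \<open>M\<close> never holds and any constants
  do. Otherwise one bound \<open>M0\<close> is fixed, on which the constants may depend; they must
  not depend on \<open>M\<close>.\<close>
proof (cases "\<exists>M0. \<forall>\<tau>\<in>{0..T}.
    onorm (\<lambda>x. meanBPi (adjB B) Pm (T - \<tau>) x - cubBPi (adjB B) Pm s N \<alpha> nd (T - \<tau>) x)
      + norm (meanBh (adjB B) hH \<tau> - cubBh (adjB B) hH s N \<alpha> nd \<tau>) \<le> M0")
  case False
  then show ?thesis by (intro exI[of _ 1] conjI) auto
next
  case True
  let ?mPi = "meanBPi (adjB B) Pm" and ?mh = "meanBh (adjB B) hH"
    and ?cPi = "cubBPi (adjB B) Pm s N \<alpha> nd" and ?ch = "cubBh (adjB B) hH s N \<alpha> nd"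
  define \<delta> where "\<delta> \<tau> = onorm (\<lambda>x. ?mPi (T - \<tau>) x - ?cPi (T - \<tau>) x)" for \<tau>
  define \<eta> where "\<eta> \<tau> = norm (?mh \<tau> - ?ch \<tau>)" for \<tau>
  obtain M0 where M0: "\<And>\<tau>. \<tau> \<in> {0..T} \<Longrightarrow> \<delta> \<tau> + \<eta> \<tau> \<le> M0" using True unfolding \<delta>_def \<eta>_def by blast
  have \<eta>: "0 \<le> \<eta> \<tau>" for \<tau> by (simp add: \<eta>_def)
  \<comment> \<open>(A2) allows a negative \<open>\<rho>\<close>, whereas
    \<open>m_dissipative\<close> asks for a nonnegative one.\<close>
  define r where "r = max \<rho> 0"
  have r: "r \<ge> 0" by (simp add: r_def)
  have garding: "\<theta> * (norm v)\<^sup>2 \<le> - A \<sigma> v v + r * (norm (\<iota> v))\<^sup>2" if "\<sigma> \<in> Sfrak" for \<sigma> v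
  proof -
    have "\<rho> * (norm (\<iota> v))\<^sup>2 \<le> r * (norm (\<iota> v))\<^sup>2" by (intro mult_right_mono) (auto simp: r_def)
    moreover have "\<theta> * (norm v)\<^sup>2 \<le> - A \<sigma> v v + \<rho> * (norm (\<iota> v))\<^sup>2" using A2(2) that by blast
    ultimately show ?thesis by linarith
  qed
  define D where "D = exp (2 * r * T)"
  define CP where "CP = norm B * (D\<^sup>2 * ((norm P)\<^sup>2 + T * (norm Q)\<^sup>2))"
  have CP: "CP \<ge> 0" using T_pos by (simp add: CP_def)
  have BPi: "norm (adjB B (Pm \<sigma> \<tau> x)) \<le> CP * norm x" if "\<sigma> \<in> Sfrak" "\<tau> \<in> {0..T}" for \<sigma> \<tau> x
  proof -
    have "norm (Pm \<sigma> \<tau> x) \<le> D\<^sup>2 * ((norm P)\<^sup>2 + T * (norm Q)\<^sup>2) * norm x"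
      unfolding D_def using Pi_sol that
      by (intro riccati_sol_norm_le[OF gelfand A2(1) r garding]) auto
    then have "norm B * norm (Pm \<sigma> \<tau> x) \<le> CP * norm x"
      unfolding CP_def mult.assoc by (intro mult_left_mono) auto
    then show ?thesis using norm_adjB_le order_trans by blast
  qed
  have node: "trunc s (nd k) \<in> Sfrak" if "k < N" for k
    using nodes that by (intro trunc_in_Sfrak) auto
  define C where "C = (\<Sum>k<N. \<bar>\<alpha> k\<bar>) * CP"
  have C: "C \<ge> 0" using CP by (simp add: C_def sum_nonneg)
  have mPi_le: "norm (?mPi \<tau> x) \<le> CP * norm x" if "\<tau> \<in> {0..T}" for \<tau> x
    using BPi that CP by (intro meanBPi_norm_le) auto
  have cPi_le: "norm (?cPi \<tau> x) \<le> C * norm x" if "\<tau> \<in> {0..T}" for \<tau> x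
    unfolding C_def mult.assoc using BPi node that by (intro cubBPi_norm_le) auto
  have \<delta>: "norm (?mPi (T - \<tau>) x - ?cPi (T - \<tau>) x) \<le> \<delta> \<tau> * norm x" "0 \<le> \<delta> \<tau>" if "\<tau> \<in> {0..T}" for \<tau> x
  proof -
    have "norm (?mPi (T - \<tau>) x - ?cPi (T - \<tau>) x) \<le> (CP + C) * norm x" for x
      using mPi_le[of "T - \<tau>" x] cPi_le[of "T - \<tau>" x] that
      by (intro norm_triangle_le_diff) (simp add: distrib_right)
    from norm_le_onorm[where f = "\<lambda>x. ?mPi (T - \<tau>) x - ?cPi (T - \<tau>) x", OF this]
    show "norm (?mPi (T - \<tau>) x - ?cPi (T - \<tau>) x) \<le> \<delta> \<tau> * norm x" "0 \<le> \<delta> \<tau>"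
      unfolding \<delta>_def by auto
  qed
  have M0_nonneg: "0 \<le> M0" using M0[of 0] \<delta>(2)[of 0] \<eta>[of 0] T_pos by simp
  \<comment> \<open>Finitely many continuous functions are summed, so compactness alone bounds the
    cubature of h.\<close>
  have "continuous_on {0..T} ?ch"
    unfolding cubBh_def adjB_def using h_sol node
    by (intro continuous_intros) (auto simp: adj_sol_def)
  from compact_imp_bounded[OF compact_continuous_image[OF this compact_Icc]]
  have "\<exists>h. \<forall>\<tau>\<in>{0..T}. norm (?ch \<tau>) \<le> h" by (auto simp: bounded_iff)
  then obtain h where h: "\<And>\<tau>. \<tau> \<in> {0..T} \<Longrightarrow> norm (?ch \<tau>) \<le> h" by blast
  have h_nonneg: "0 \<le> h" using order_trans[OF norm_ge_zero h[of 0]] T_pos by simp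
  \<comment> \<open>\<open>1 + (norm (f \<tau>))\<^sup>2\<close> dominates
    \<open>norm (f \<tau>)\<close> and is integrable because \<open>f\<close> is square
    integrable.\<close>
  define k where "k \<tau> = norm B * h + 1 + (norm (f \<tau>))\<^sup>2" for \<tau>
  have k: "set_integrable lborel {0..T} k"
  proof -
    have "set_integrable lborel {0..T} (\<lambda>\<tau>. norm B * h + 1)"
      by (intro borel_integrable_atLeastAtMost' continuous_intros)
    moreover have "set_integrable lborel {0..T} (\<lambda>\<tau>. (norm (f \<tau>))\<^sup>2)"
      using f_L2 by (simp add: L2_def)
    ultimately show ?thesis unfolding k_def by (rule set_integral_add)
  qed
  \<comment> \<open>The Gronwall bound for yhat with initial value \<open>y0\<close>, forcing
    \<open>k\<close> and rate \<open>norm B * C\<close>; none of these involves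
    \<open>\<sigma>\<close>.\<close>
  define Y where "Y = 2 * (D * (norm y0 + (LINT \<tau>:{0..T}|lborel. k \<tau>))) * exp (2 * (D * (norm B * C + 1)) * T)"
  let ?F = "\<lambda>t x. - ?mPi (T - t) x - ?mh t" and ?Fh = "\<lambda>t x. - ?cPi (T - t) x - ?ch t"
  have Y: "norm (yhH \<sigma> t) \<le> Y" if \<sigma>: "\<sigma> \<in> Sfrak" and t: "t \<in> {0..T}" for \<sigma> t
  proof -
    have "closed_loop_sol T \<iota> (A \<sigma>) B ?Fh f y0 (yhH \<sigma>) (yhV \<sigma>)" using yh_sol \<sigma> by blast
    note sol = closed_loop_sol_weak_evolution[OF this] and init = closed_loop_sol_init[OF this]
    have "norm (yhH \<sigma> t) \<le> 2 * (exp (2 * r * T) * (norm (yhH \<sigma> 0) + (LINT s:{0..T}|lborel. k s)))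
        * exp (2 * (exp (2 * r * T) * (norm B * C + 1)) * T)"
    proof (rule weak_evolution_gronwall[OF gelfand A2(1) r garding[OF \<sigma>] sol k _ _ _ t])
      fix \<tau> assume \<tau>: "\<tau> \<in> {0..T}"
      show "0 \<le> k \<tau>" using h_nonneg by (simp add: k_def)
      have "norm (?Fh \<tau> (yhH \<sigma> \<tau>)) \<le> C * norm (yhH \<sigma> \<tau>) + h"
        using cPi_le[of "T - \<tau>" "yhH \<sigma> \<tau>"] h[OF \<tau>] \<tau> by (intro norm_triangle_le_diff) simp
      then have "norm B * norm (?Fh \<tau> (yhH \<sigma> \<tau>)) \<le> norm B * (C * norm (yhH \<sigma> \<tau>) + h)"
        by (intro mult_left_mono) auto
      then have "norm (B (?Fh \<tau> (yhH \<sigma> \<tau>))) \<le> norm B * (C * norm (yhH \<sigma> \<tau>) + h)"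
        using norm_blinfun order_trans by blast
      moreover have "2 * norm (f \<tau>) \<le> 1 + (norm (f \<tau>))\<^sup>2"
        using zero_le_power2[of "norm (f \<tau>) - 1"] by (simp add: power2_diff)
      then have "norm (f \<tau>) \<le> 1 + (norm (f \<tau>))\<^sup>2"
        using norm_ge_zero[of "f \<tau>"] by linarith
      ultimately show "norm (B (?Fh \<tau> (yhH \<sigma> \<tau>)) + f \<tau>) \<le> k \<tau> + norm B * C * norm (yhH \<sigma> \<tau>)"
        unfolding k_def by (intro norm_triangle_le) (simp add: algebra_simps)
    qed (use C in auto)
    then show ?thesis by (simp add: Y_def D_def init)
  qed
  \<comment> \<open>The Lipschitz rate of the feedback error in e: \<open>C\<close> from the
    cubature operator acting on e, and \<open>M0\<close> from
    \<open>\<delta> \<tau> * norm (yH \<sigma> \<tau>)\<close> after splitting the mean-feedback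
    state into yhat and e.\<close>
  define c where "c = M0 + C"
  have c: "0 \<le> c" using M0_nonneg C by (simp add: c_def)
  \<comment> \<open>Gronwall for e with zero initial value and the constant forcing
    \<open>norm B * ((\<bar>Y\<bar> + 1) * M)\<close>, which integrates to \<open>T\<close> times
    itself. The final \<open>+ 1\<close> keeps the constant positive when \<open>B\<close>
    vanishes.\<close>
  define Cy where "Cy = 2 * D * T * norm B * (\<bar>Y\<bar> + 1) * exp (2 * (D * (norm B * c + 1)) * T) + 1"
  have Cy: "Cy > 0" using T_pos by (auto simp: Cy_def D_def intro!: add_nonneg_pos)
  define Cu where "Cu = \<bar>Y\<bar> + 1 + c * Cy"
  have Cu: "Cu > 0" using mult_nonneg_nonneg[OF c less_imp_le[OF Cy]] unfolding Cu_def by linarith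
  have main: "norm (yH \<sigma> t - yhH \<sigma> t) \<le> Cy * M \<and> norm (?F t (yH \<sigma> t) - ?Fh t (yhH \<sigma> t)) \<le> Cu * M"
    if \<sigma>: "\<sigma> \<in> Sfrak" and t: "t \<in> {0..T}" and M: "\<And>\<tau>. \<tau> \<in> {0..T} \<Longrightarrow> \<delta> \<tau> + \<eta> \<tau> \<le> M" for \<sigma> t M
  proof -
    have M_nonneg: "0 \<le> M" using M[of 0] \<delta>(2)[of 0] \<eta>[of 0] T_pos by simp
    let ?e = "\<lambda>t. yH \<sigma> t - yhH \<sigma> t"
    have triangle: "norm (- (a + b + c)) \<le> norm a + norm b + norm c" for a b c :: 'u
      using norm_triangle_ineq[of "a + b" c] norm_triangle_ineq[of a b] unfolding norm_minus_cancel by linarith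
    have u: "norm (?F \<tau> (yH \<sigma> \<tau>) - ?Fh \<tau> (yhH \<sigma> \<tau>)) \<le> (\<bar>Y\<bar> + 1) * M + c * norm (?e \<tau>)" if \<tau>: "\<tau> \<in> {0..T}" for \<tau>
    proof -
      \<comment> \<open>only the cubature operator is known to be linear, so it is the one that acts on the error\<close>
      have "?F \<tau> (yH \<sigma> \<tau>) - ?Fh \<tau> (yhH \<sigma> \<tau>) = - ((?mPi (T - \<tau>) (yH \<sigma> \<tau>) - ?cPi (T - \<tau>) (yH \<sigma> \<tau>))
          + ?cPi (T - \<tau>) (?e \<tau>) + (?mh \<tau> - ?ch \<tau>))"
        by (simp add: cubBPi_diff)
      then have "norm (?F \<tau> (yH \<sigma> \<tau>) - ?Fh \<tau> (yhH \<sigma> \<tau>))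
          \<le> norm (?mPi (T - \<tau>) (yH \<sigma> \<tau>) - ?cPi (T - \<tau>) (yH \<sigma> \<tau>)) + norm (?cPi (T - \<tau>) (?e \<tau>)) + \<eta> \<tau>"
        by (simp only: \<eta>_def triangle)
      moreover have "norm (?cPi (T - \<tau>) (?e \<tau>)) \<le> C * norm (?e \<tau>)"
        using \<tau> by (intro cPi_le) auto
      moreover note \<delta>(1)[OF \<tau>, of "yH \<sigma> \<tau>"]
      moreover have "\<delta> \<tau> * norm (yH \<sigma> \<tau>) \<le> \<delta> \<tau> * (\<bar>Y\<bar> + norm (?e \<tau>))"
        using norm_triangle_ineq[of "yhH \<sigma> \<tau>" "?e \<tau>"] Y[OF \<sigma> \<tau>] \<delta>(2)[OF \<tau>]
        by (intro mult_left_mono) auto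
      moreover have "\<delta> \<tau> * norm (?e \<tau>) \<le> M0 * norm (?e \<tau>)"
        using M0[OF \<tau>] \<eta>[of \<tau>] by (intro mult_right_mono) auto
      moreover have "\<delta> \<tau> * \<bar>Y\<bar> + \<eta> \<tau> \<le> (\<bar>Y\<bar> + 1) * M"
      proof -
        have "\<delta> \<tau> * \<bar>Y\<bar> + \<eta> \<tau> \<le> (\<bar>Y\<bar> + 1) * (\<delta> \<tau> + \<eta> \<tau>)"
          using \<delta>(2)[OF \<tau>] \<eta>[of \<tau>] by (simp add: algebra_simps)
        also have "\<dots> \<le> (\<bar>Y\<bar> + 1) * M" using M[OF \<tau>] by (intro mult_left_mono) auto
        finally show ?thesis .
      qed
      ultimately show ?thesis by (simp add: c_def distrib_left distrib_right)
    qed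
    have e: "norm (?e t) \<le> Cy * M"
    proof -
      have sol: "weak_evolution T \<iota> (A \<sigma>)
          (\<lambda>\<tau>. (B (?F \<tau> (yH \<sigma> \<tau>)) + f \<tau>) - (B (?Fh \<tau> (yhH \<sigma> \<tau>)) + f \<tau>)) ?e (\<lambda>\<tau>. yV \<sigma> \<tau> - yhV \<sigma> \<tau>)"
        using y_sol yh_sol \<sigma> by (intro weak_evolution_diff closed_loop_sol_weak_evolution) auto
      have init: "?e 0 = 0" using y_sol yh_sol \<sigma> by (auto simp: closed_loop_sol_def)
      have "norm (?e t) \<le> 2 * (exp (2 * r * T) * (norm (?e 0) + (LINT s:{0..T}|lborel. norm B * ((\<bar>Y\<bar> + 1) * M))))
          * exp (2 * (exp (2 * r * T) * (norm B * c + 1)) * T)"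
      proof (rule weak_evolution_gronwall[OF gelfand A2(1) r garding[OF \<sigma>] sol _ _ _ _ t])
        show "set_integrable lborel {0..T} (\<lambda>s. norm B * ((\<bar>Y\<bar> + 1) * M))"
          by (intro borel_integrable_atLeastAtMost' continuous_intros)
        fix \<tau> assume \<tau>: "\<tau> \<in> {0..T}"
        show "0 \<le> norm B * ((\<bar>Y\<bar> + 1) * M)" using M_nonneg by simp
        have "norm (B (?F \<tau> (yH \<sigma> \<tau>) - ?Fh \<tau> (yhH \<sigma> \<tau>))) \<le> norm B * ((\<bar>Y\<bar> + 1) * M + c * norm (?e \<tau>))"
          by (intro order_trans[OF norm_blinfun] mult_left_mono u \<tau>) auto
        then show "norm ((B (?F \<tau> (yH \<sigma> \<tau>)) + f \<tau>) - (B (?Fh \<tau> (yhH \<sigma> \<tau>)) + f \<tau>))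
            \<le> norm B * ((\<bar>Y\<bar> + 1) * M) + norm B * c * norm (?e \<tau>)"
          by (simp only: blinfun.diff_right add_diff_cancel_right distrib_left mult.assoc)
      qed (use c in auto)
      also have "\<dots> = (Cy - 1) * M"
        using T_pos by (simp add: init Cy_def D_def set_lebesgue_integral_def mult_ac)
      finally show ?thesis using M_nonneg by (simp add: left_diff_distrib)
    qed
    have "norm (?F t (yH \<sigma> t) - ?Fh t (yhH \<sigma> t)) \<le> (\<bar>Y\<bar> + 1) * M + c * (Cy * M)"
      using u[OF t] mult_left_mono[OF e c] by linarith
    also have "\<dots> = Cu * M" by (simp add: Cu_def algebra_simps)
    finally show ?thesis using e by blast
  qed
  show ?thesis
    by (rule exI[of _ Cy], rule conjI[OF Cy], rule exI[of _ Cu], rule conjI[OF Cu],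
        intro ballI allI impI, rule main) (simp_all add: \<delta>_def \<eta>_def)
qed

end
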